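(* Let $[A]\in\mathcal E$ be a verge with set of main conditions $\mathfrak p=\{(i_1,j_1),\ldots,(i_k,j_k)\}$, and let $\mathcal S\leqslant\mathbb C\mathcal O_A^r$ be an irreducible submodule of minimal dimension. Then $\mathfrak p\subseteq\Phi^+$ is hook disconnected. Moreover there exists a linear character $\lambda:U_{\hat{\mathcal R}}\to\mathbb C^*$ having $U_{\mathcal R^\circ}$ in its kernel, such that the restriction of $\lambda$ to $U_{\mathcal R}$ is $\theta_A$ and $(U_{\hat{\mathcal R}},\lambda)$ is a monomial source of $\mathcal S$, that is, $\mathcal S\cong\operatorname{Ind}_{U_{\hat{\mathcal R}}}^U\mathbb C_\lambda$, where $\mathbb C_\lambda$ is the one-dimensional $\mathbb C U_{\hat{\mathcal R}}$-module affording $\lambda$.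
   Context: Let $q$ be a power of a prime, $n$ a natural number, $U=U_n(q)$ the group of lower unitriangular $n\times n$ matrices over $\mathbb F_q$, and $V$ the additive group of strictly lower triangular $n\times n$ matrices over $\mathbb F_q$. Put $\Phi^+=\{(i,j): 1\leqslant j<i\leqslant n\}$. A subset $J\subseteq\Phi^+$ is closed if $(i,j),(j,k)\in J$ implies $(i,k)\in J$; then $U_J=\{u\in U: u_{ij}=0 \text{ for all } (i,j)\in\Phi^+\setminus J\}$ is a subgroup of $U$ (a pattern subgroup). Fix a nontrivial character $\theta:(\mathbb F_q,+)\to\mathbb C^*$, and for $A\in V$ let $\chi_A:V\to\mathbb C^*$, $\chi_A(B)=\theta\big(\sum_{i,j}A_{ij}B_{ij}\big)$. For an $n\times n$ matrix $M$ let $\overline M\in V$ be obtained by setting all entries on and above the diagonal to zero; write $u^{-t}=(u^{-1})^t$. Let $\mathcal E=\{[A]: A\in V\}$ and let $\mathbb C\mathcal E$ be the $\mathbb C$-space with basis $\mathcal E$, made into a right $\mathbb C U$-module by $[A]u=\chi_A(1-u^{-1})\,[\overline{Au^{-t}}]$ for $u\in U$ (it is isomorphic to the regular module $\mathbb C U$). Let $\mathcal O_A^r=\{[\overline{Au^{-t}}]:u\in U\}$; its span $\mathbb C\mathcal O_A^r=[A]\mathbb C U$ is a right $\mathbb C U$-module. $[A]\in\mathcal E$ is a verge if $A$ has at most one nonzero entry in each row and in each column; its main conditions are the positions of the nonzero entries of $A$. For $(i,j)\in\Phi^+$ the hook centered at $(i,j)$ is $h_{ij}=\{(i,k):j<k<i\}\cup\{(l,j):j<l<i\}\cup\{(i,j)\}$.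 A hook intersection is a position in $h_{ij}\cap h_{rs}$ for two distinct main conditions $(i,j),(r,s)$; it occurs exactly when (up to exchanging the two) $j<s<i<r$, and then $h_{ij}\cap h_{rs}=\{(i,s)\}$. Let $a=\sum_\nu(i_\nu-j_\nu-1)$ and let $b$ be the number of hook intersections. An irreducible submodule (constituent) of $\mathbb C\mathcal O_A^r$ has minimal dimension if its dimension equals $q^{a-b}$, which is a lower bound for the dimensions of all irreducible constituents of $\mathbb C\mathcal O_A^r$. Two main conditions $(i_\nu,j_\nu),(i_\mu,j_\mu)\in\mathfrak p$ are connected in $\mathfrak p$ if both: (i) $j_\nu=i_\mu$ or $j_\mu=i_\nu$; and (ii) there is $\rho\in\{1,\ldots,k\}$ such that $h_{i_\rho j_\rho}$ intersects both $h_{i_\nu j_\nu}$ and $h_{i_\mu j_\mu}$, each in precisely one position of $\Phi^+$. If there is no pair of connected main conditions in $\mathfrak p$, then $\mathfrak p$ is called hook disconnected. Set $\mathcal R=\{(r,s)\in\Phi^+: s\notin\{j_1,\ldots,j_k\}\}\cup\{(r,j_\nu): 1\leqslant\nu\leqslant k,\ i_\nu\leqslant r\leqslant n\}$, $\mathcal R^\circ=\mathcal R\setminus\mathfrak p$, and $\hat{\mathcal R}=\mathcal R\cup\{(s,j)\in\Phi^+:\ \exists\, i,r \text{ with } (i,j),(r,s)\in\mathfrak p,\ 1\leqslant j<s<i<r\leqslant n\}$. These are closed subsets of $\Phi^+$. The linear character $\theta_A:U_{\mathcal R}\to\mathbb C^*$ is trivial on $U_{\mathcal R^\circ}$ and satisfies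 $\theta_A(x_{i_\nu j_\nu}(\alpha))=\theta(A_{i_\nu j_\nu}\alpha)$ for $\alpha\in\mathbb F_q$, $1\leqslant\nu\leqslant k$, where $x_{ij}(\alpha)=E_n+\alpha\epsilon_{ij}$ with $E_n$ the identity matrix and $\epsilon_{ij}$ the matrix unit; $U_{\mathcal R^\circ}$ is normal in $U_{\mathcal R}$ with $U_{\mathcal R}/U_{\mathcal R^\circ}$ isomorphic to the direct product of the root subgroups $X_{i_\nu j_\nu}=\{x_{i_\nu j_\nu}(\alpha):\alpha\in\mathbb F_q\}$. *)

theory Defs
  imports
    "HOL-Library.Function_Algebras"
    "HOL-Library.FuncSet"
    "HOL-Algebra.Group"
    "Jordan_Normal_Form.Determinant"
begin

text \<open>
  The field with q elements is a type \<open>'a :: {field, finite}\<close>, so \<open>q = card (UNIV :: 'a set)\<close>.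
  Rows and columns of matrices are numbered \<open>0, \<dots>, n - 1\<close> throughout; thus a position
  \<open>(i, j)\<close> of the literature (with \<open>1 \<le> i, j \<le> n\<close>) is here \<open>(i - 1, j - 1)\<close>.
\<close>

subsection \<open>Complex function spaces and modules over group algebras\<close>

text \<open>
  All modules live inside function spaces \<open>'x \<Rightarrow> complex\<close>, with pointwise addition.
\<close>

definition cscale :: "complex \<Rightarrow> ('x \<Rightarrow> complex) \<Rightarrow> 'x \<Rightarrow> complex" where
  "cscale c f = (\<lambda>x. c * f x)"

interpretation cfun: vector_space "cscale :: complex \<Rightarrow> ('x \<Rightarrow> complex) \<Rightarrow> 'x \<Rightarrow> complex"
  by unfold_locales (auto simp: cscale_def fun_eq_iff algebra_simps)

definition basis_fun :: "'x \<Rightarrow> 'x \<Rightarrow> complex" where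
  "basis_fun x = (\<lambda>y. if y = x then 1 else 0)"

text \<open>
  A right action of a group \<open>G\<close> is given as a function \<open>act\<close>, with \<open>act f g\<close> for \<open>f g\<close>.
\<close>

definition G_submodule ::
  "('g, 'm) monoid_scheme \<Rightarrow> (('x \<Rightarrow> complex) \<Rightarrow> 'g \<Rightarrow> ('x \<Rightarrow> complex)) \<Rightarrow> ('x \<Rightarrow> complex) set \<Rightarrow> bool"
where
  "G_submodule G act W \<longleftrightarrow>
     cfun.subspace W \<and> (\<forall>f\<in>W. \<forall>g\<in>carrier G. act f g \<in> W)"

definition G_irreducible ::
  "('g, 'm) monoid_scheme \<Rightarrow> (('x \<Rightarrow> complex) \<Rightarrow> 'g \<Rightarrow> ('x \<Rightarrow> complex)) \<Rightarrow> ('x \<Rightarrow> complex) set \<Rightarrow> bool"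
where
  "G_irreducible G act W \<longleftrightarrow>
     G_submodule G act W \<and> W \<noteq> {0} \<and>
     (\<forall>W'. G_submodule G act W' \<and> W' \<subseteq> W \<longrightarrow> W' = {0} \<or> W' = W)"

definition G_isomorphic ::
  "('g, 'm) monoid_scheme
     \<Rightarrow> (('x \<Rightarrow> complex) \<Rightarrow> 'g \<Rightarrow> ('x \<Rightarrow> complex)) \<Rightarrow> ('x \<Rightarrow> complex) set
     \<Rightarrow> (('y \<Rightarrow> complex) \<Rightarrow> 'g \<Rightarrow> ('y \<Rightarrow> complex)) \<Rightarrow> ('y \<Rightarrow> complex) set \<Rightarrow> bool"
where
  "G_isomorphic G act1 W1 act2 W2 \<longleftrightarrow>
     (\<exists>\<phi>. bij_betw \<phi> W1 W2 \<and>
          (\<forall>f\<in>W1. \<forall>g\<in>W1. \<phi> (f + g) = \<phi> f + \<phi> g) \<and>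
          (\<forall>c. \<forall>f\<in>W1. \<phi> (cscale c f) = cscale c (\<phi> f)) \<and>
          (\<forall>f\<in>W1. \<forall>u\<in>carrier G. \<phi> (act1 f u) = act2 (\<phi> f) u))"

text \<open>
  Only the values of a linear character on the subgroup \<open>H\<close> are relevant.
\<close>

definition linear_character :: "('g, 'm) monoid_scheme \<Rightarrow> 'g set \<Rightarrow> ('g \<Rightarrow> complex) \<Rightarrow> bool" where
  "linear_character G H \<psi> \<longleftrightarrow>
     (\<forall>x\<in>H. \<psi> x \<noteq> 0) \<and> (\<forall>x\<in>H. \<forall>y\<in>H. \<psi> (x \<otimes>\<^bsub>G\<^esub> y) = \<psi> x * \<psi> y)"

text \<open>
  The right module induced from the one-dimensional right \<open>H\<close>-module affording \<open>\<psi>\<close>, in its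
  function model: all \<open>f : G \<rightarrow> \<complex>\<close> (extended by 0) with \<open>f (x h) = f x * \<psi> h\<close>, where \<open>G\<close>
  acts from the right by \<open>(f g) x = f (g x)\<close>.  The function \<open>f\<^sub>0\<close> that is \<open>\<psi>\<close> on \<open>H\<close>
  and 0 elsewhere satisfies \<open>f\<^sub>0 h = \<psi> h f\<^sub>0\<close> for \<open>h \<in> H\<close>, and its translates \<open>f\<^sub>0 g\<close>,
  with \<open>g\<close> in a transversal of the right cosets \<open>H g\<close>, are a basis (\<open>f\<^sub>0 g\<close> is supported on
  \<open>g\<^sup>-\<^sup>1 H\<close>).  Hence \<open>1 \<otimes> g \<mapsto> f\<^sub>0 g\<close> identifies the tensor product of the module of \<open>\<psi>\<close>
  with the group algebra of \<open>G\<close> over that of \<open>H\<close> with this module.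
\<close>

definition induced_module ::
  "('g, 'm) monoid_scheme \<Rightarrow> 'g set \<Rightarrow> ('g \<Rightarrow> complex) \<Rightarrow> ('g \<Rightarrow> complex) set"
where
  "induced_module G H \<psi> =
     {f. (\<forall>x. x \<notin> carrier G \<longrightarrow> f x = 0) \<and>
         (\<forall>x\<in>carrier G. \<forall>h\<in>H. f (x \<otimes>\<^bsub>G\<^esub> h) = f x * \<psi> h)}"

definition induced_action ::
  "('g, 'm) monoid_scheme \<Rightarrow> ('g \<Rightarrow> complex) \<Rightarrow> 'g \<Rightarrow> ('g \<Rightarrow> complex)"
where
  "induced_action G f g = (\<lambda>x. if x \<in> carrier G then f (g \<otimes>\<^bsub>G\<^esub> x) else 0)"


subsection \<open>Unitriangular groups and pattern subgroups\<close>

definition Phi :: "nat \<Rightarrow> (nat \<times> nat) set" where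
  "Phi n = {(i, j). j < i \<and> i < n}"

definition strict_lower :: "nat \<Rightarrow> 'a :: zero mat set" where
  "strict_lower n = {A \<in> carrier_mat n n. \<forall>i<n. \<forall>j<n. i \<le> j \<longrightarrow> A $$ (i, j) = 0}"

definition unitri :: "nat \<Rightarrow> 'a :: field mat monoid" where
  "unitri n =
     \<lparr>carrier = {u \<in> carrier_mat n n.
        (\<forall>i<n. u $$ (i, i) = 1) \<and> (\<forall>i<n. \<forall>j<n. i < j \<longrightarrow> u $$ (i, j) = 0)},
      mult = (*),
      one = 1\<^sub>m n\<rparr>"

lemma unitri_group: "group (unitri n :: 'a :: field mat monoid)"
proof (rule groupI)
  fix x y :: "'a mat"
  assume x: "x \<in> carrier (unitri n)" and y: "y \<in> carrier (unitri n)"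
  have c: "x \<in> carrier_mat n n" "y \<in> carrier_mat n n"
    using x y by (auto simp: unitri_def)
  have e: "(x * y) $$ (i, j) = (\<Sum>k<n. x $$ (i, k) * y $$ (k, j))" if "i < n" "j < n" for i j
    using c that by (auto simp: scalar_prod_def lessThan_atLeast0)
  have d: "(x * y) $$ (i, i) = 1" if i: "i < n" for i
  proof -
    have "(x * y) $$ (i, i) = (\<Sum>k<n. if k = i then 1 else 0)"
      unfolding e[OF i i]
    proof (rule sum.cong)
      fix k assume "k \<in> {..<n}"
      then show "x $$ (i, k) * y $$ (k, i) = (if k = i then 1 else 0)"
        using x y i by (cases k i rule: linorder_cases) (auto simp: unitri_def)
    qed simp
    then show ?thesis using i by simp
  qed
  have z: "(x * y) $$ (i, j) = 0" if "i < n" "j < n" "i < j" for i j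
    unfolding e[OF that(1,2)]
  proof (rule sum.neutral, intro ballI)
    fix k assume "k \<in> {..<n}"
    then show "x $$ (i, k) * y $$ (k, j) = 0"
      using x y that by (cases "i < k") (auto simp: unitri_def)
  qed
  show "x \<otimes>\<^bsub>unitri n\<^esub> y \<in> carrier (unitri n)"
    using c d z by (auto simp: unitri_def)
next
  show "\<one>\<^bsub>unitri n\<^esub> \<in> carrier (unitri n :: 'a mat monoid)"
    by (auto simp: unitri_def)
next
  fix x y z :: "'a mat"
  assume "x \<in> carrier (unitri n)" "y \<in> carrier (unitri n)" "z \<in> carrier (unitri n)"
  then show "x \<otimes>\<^bsub>unitri n\<^esub> y \<otimes>\<^bsub>unitri n\<^esub> z = x \<otimes>\<^bsub>unitri n\<^esub> (y \<otimes>\<^bsub>unitri n\<^esub> z)"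
    by (auto simp: unitri_def)
next
  fix x :: "'a mat"
  assume x: "x \<in> carrier (unitri n)"
  then show "\<one>\<^bsub>unitri n\<^esub> \<otimes>\<^bsub>unitri n\<^esub> x = x"
    by (auto simp: unitri_def)
  have c: "x \<in> carrier_mat n n" using x by (auto simp: unitri_def)
  have "det x = prod_list (diag_mat x)"
    using x by (intro det_lower_triangular[OF _ c]) (auto simp: unitri_def)
  also have "diag_mat x = map (\<lambda>_. 1) [0..<n]"
    using x c by (auto simp: diag_mat_def unitri_def)
  finally have "det x = 1" by (simp add: map_replicate_const)
  then obtain y where y: "y \<in> carrier_mat n n" "y * x = 1\<^sub>m n"
    using det_non_zero_imp_unit[OF c, where b = "()"] by (auto simp: Units_def ring_mat_def)
  have e: "(\<Sum>k<n. y $$ (i, k) * x $$ (k, j)) = (if i = j then 1 else 0)"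
    if "i < n" "j < n" for i j
  proof -
    have "(y * x) $$ (i, j) = (\<Sum>k<n. y $$ (i, k) * x $$ (k, j))"
      using c y(1) that by (auto simp: scalar_prod_def lessThan_atLeast0)
    then show ?thesis using y(2) that by simp
  qed
  have step: "y $$ (i, j) = (if i = j then 1 else 0)" if i: "i < n" and "i \<le> j" "j < n" for i j
    using that(2,3)
  proof (induction "n - j" arbitrary: j rule: less_induct)
    case less
    have "(\<Sum>k<n. y $$ (i, k) * x $$ (k, j)) = (\<Sum>k<n. if k = j then y $$ (i, j) else 0)"
    proof (rule sum.cong)
      fix k assume k: "k \<in> {..<n}"
      show "y $$ (i, k) * x $$ (k, j) = (if k = j then y $$ (i, j) else 0)"
      proof (cases k j rule: linorder_cases)
        case greater
        then have "y $$ (i, k) = 0" using less.hyps[of k] less.prems k by auto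
        then show ?thesis using greater by simp
      qed (use x k less.prems in \<open>auto simp: unitri_def\<close>)
    qed simp
    then show ?case using e[OF i less.prems(2)] less.prems by simp
  qed
  have "y \<in> carrier (unitri n)" using y(1) step by (auto simp: unitri_def)
  then show "\<exists>y\<in>carrier (unitri n). y \<otimes>\<^bsub>unitri n\<^esub> x = \<one>\<^bsub>unitri n\<^esub>"
    using y(2) by (auto simp: unitri_def)
qed

definition pattern_subgroup :: "nat \<Rightarrow> (nat \<times> nat) set \<Rightarrow> 'a :: field mat set" where
  "pattern_subgroup n J =
     {u \<in> carrier (unitri n). \<forall>(i, j) \<in> Phi n - J. u $$ (i, j) = 0}"

definition root_elem :: "nat \<Rightarrow> nat \<Rightarrow> nat \<Rightarrow> 'a :: field \<Rightarrow> 'a mat" where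
  "root_elem n i j \<alpha> =
     1\<^sub>m n + \<alpha> \<cdot>\<^sub>m mat n n (\<lambda>(r, s). if (r, s) = (i, j) then 1 else 0)"

lemma finite_strict_lower: "finite (strict_lower n :: 'a :: {zero, finite} mat set)"
proof -
  have "strict_lower n \<subseteq> (\<lambda>f. mat n n f) ` (({..<n} \<times> {..<n}) \<rightarrow>\<^sub>E (UNIV :: 'a set))"
  proof
    fix A :: "'a mat" assume "A \<in> strict_lower n"
    then have A: "A = mat n n (restrict (\<lambda>p. A $$ p) ({..<n} \<times> {..<n}))"
      by (intro eq_matI) (auto simp: strict_lower_def)
    show "A \<in> (\<lambda>f. mat n n f) ` (({..<n} \<times> {..<n}) \<rightarrow>\<^sub>E (UNIV :: 'a set))"
      by (subst A) (intro imageI, auto split: if_splits)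
  qed
  then show ?thesis
    by (rule finite_subset) (intro finite_imageI finite_PiE; simp)
qed

definition lower_part :: "nat \<Rightarrow> 'a :: zero mat \<Rightarrow> 'a mat" where
  "lower_part n M = mat n n (\<lambda>(i, j). if j < i then M $$ (i, j) else 0)"


subsection \<open>The monomial module\<close>

definition nontrivial_add_char :: "('a :: field \<Rightarrow> complex) \<Rightarrow> bool" where
  "nontrivial_add_char \<theta> \<longleftrightarrow>
     (\<forall>x. \<theta> x \<noteq> 0) \<and> (\<forall>x y. \<theta> (x + y) = \<theta> x * \<theta> y) \<and> (\<exists>x. \<theta> x \<noteq> 1)"

definition chi :: "('a :: field \<Rightarrow> complex) \<Rightarrow> nat \<Rightarrow> 'a mat \<Rightarrow> 'a mat \<Rightarrow> complex" where
  "chi \<theta> n A B = \<theta> (\<Sum>i<n. \<Sum>j<n. A $$ (i, j) * B $$ (i, j))"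

definition E_dot :: "nat \<Rightarrow> 'a :: field mat \<Rightarrow> 'a mat \<Rightarrow> 'a mat" where
  "E_dot n A u = lower_part n (A * transpose_mat (inv\<^bsub>unitri n\<^esub> u))"

text \<open>
  The basis element \<open>[A]\<close> is \<^term>\<open>basis_fun A\<close> for \<open>A\<close> in \<^term>\<open>strict_lower n\<close>, and
  the action below is the linear extension of
  \<open>[A] u = chi \<theta> n A (1 - u\<^sup>-\<^sup>1) [E_dot n A u]\<close>.
\<close>

definition E_action ::
  "('a :: {field, finite} \<Rightarrow> complex) \<Rightarrow> nat
     \<Rightarrow> ('a mat \<Rightarrow> complex) \<Rightarrow> 'a mat \<Rightarrow> ('a mat \<Rightarrow> complex)"
where
  "E_action \<theta> n f u =
     (\<Sum>A\<in>strict_lower n.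
        cscale (f A) (cscale (chi \<theta> n A (1\<^sub>m n - inv\<^bsub>unitri n\<^esub> u)) (basis_fun (E_dot n A u))))"

definition orbit_r :: "nat \<Rightarrow> 'a :: field mat \<Rightarrow> ('a mat \<Rightarrow> complex) set" where
  "orbit_r n A = {basis_fun (E_dot n A u) | u. u \<in> carrier (unitri n)}"

definition orbit_module :: "nat \<Rightarrow> 'a :: field mat \<Rightarrow> ('a mat \<Rightarrow> complex) set" where
  "orbit_module n A = cfun.span (orbit_r n A)"


subsection \<open>Verges, hooks and the associated closed sets\<close>

definition verge :: "nat \<Rightarrow> 'a :: zero mat \<Rightarrow> bool" where
  "verge n A \<longleftrightarrow> A \<in> strict_lower n \<and>
     (\<forall>i<n. \<forall>j<n. \<forall>k<n. A $$ (i, j) \<noteq> 0 \<and> A $$ (i, k) \<noteq> 0 \<longrightarrow> j = k) \<and>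
     (\<forall>i<n. \<forall>j<n. \<forall>k<n. A $$ (i, j) \<noteq> 0 \<and> A $$ (k, j) \<noteq> 0 \<longrightarrow> i = k)"

definition main_conditions :: "nat \<Rightarrow> 'a :: zero mat \<Rightarrow> (nat \<times> nat) set" where
  "main_conditions n A = {(i, j). i < n \<and> j < n \<and> A $$ (i, j) \<noteq> 0}"

definition hook :: "nat \<times> nat \<Rightarrow> (nat \<times> nat) set" where
  "hook p = (case p of (i, j) \<Rightarrow>
     {(i, k) | k. j < k \<and> k < i} \<union> {(l, j) | l. j < l \<and> l < i} \<union> {(i, j)})"

definition hook_intersections :: "(nat \<times> nat) set \<Rightarrow> (nat \<times> nat) set" where
  "hook_intersections P = {x. \<exists>p\<in>P. \<exists>p'\<in>P. p \<noteq> p' \<and> x \<in> hook p \<inter> hook p'}"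

definition a_number :: "(nat \<times> nat) set \<Rightarrow> nat" where
  "a_number P = (\<Sum>(i, j)\<in>P. i - j - 1)"

definition b_number :: "(nat \<times> nat) set \<Rightarrow> nat" where
  "b_number P = card (hook_intersections P)"

text \<open>
  The subtraction in the exponent is not truncated: for main conditions of a verge, each hook
  intersection is a non-corner position on the row part of exactly one hook.
\<close>

definition minimal_dimension :: "nat \<Rightarrow> 'a :: {field, finite} mat \<Rightarrow> ('a mat \<Rightarrow> complex) set \<Rightarrow> bool"
where
  "minimal_dimension n A S \<longleftrightarrow>
     cfun.dim S = card (UNIV :: 'a set) ^ (a_number (main_conditions n A) - b_number (main_conditions n A))"

definition connected_in :: "(nat \<times> nat) set \<Rightarrow> nat \<times> nat \<Rightarrow> nat \<times> nat \<Rightarrow> bool" where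
  "connected_in P p p' \<longleftrightarrow>
     (snd p = fst p' \<or> snd p' = fst p) \<and>
     (\<exists>r\<in>P. card (hook r \<inter> hook p) = 1 \<and> card (hook r \<inter> hook p') = 1)"

definition hook_disconnected :: "(nat \<times> nat) set \<Rightarrow> bool" where
  "hook_disconnected P \<longleftrightarrow> \<not> (\<exists>p\<in>P. \<exists>p'\<in>P. connected_in P p p')"

definition R_set :: "nat \<Rightarrow> (nat \<times> nat) set \<Rightarrow> (nat \<times> nat) set" where
  "R_set n P = {(r, s) \<in> Phi n. s \<notin> snd ` P} \<union> {(r, j) | r i j. (i, j) \<in> P \<and> i \<le> r \<and> r < n}"

definition R_circ :: "nat \<Rightarrow> (nat \<times> nat) set \<Rightarrow> (nat \<times> nat) set" where
  "R_circ n P = R_set n P - P"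

definition R_hat :: "nat \<Rightarrow> (nat \<times> nat) set \<Rightarrow> (nat \<times> nat) set" where
  "R_hat n P = R_set n P \<union>
     {(s, j) \<in> Phi n. \<exists>i r. (i, j) \<in> P \<and> (r, s) \<in> P \<and> j < s \<and> s < i \<and> i < r \<and> r < n}"

text \<open>
  The linear character of \<open>U\<^sub>R\<close> determined by the verge \<open>A\<close>.  The extensionality condition
  only fixes the (irrelevant) values outside \<open>U\<^sub>R\<close>; existence and uniqueness hold since
  \<open>U\<^sub>R\<close> modulo \<open>U\<^sub>R\<^sub>\<circ>\<close> is the direct product of the root subgroups at the main conditions.
\<close>

definition theta_A :: "('a :: field \<Rightarrow> complex) \<Rightarrow> nat \<Rightarrow> 'a mat \<Rightarrow> 'a mat \<Rightarrow> complex" where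
  "theta_A \<theta> n A =
     (let P = main_conditions n A;
          UR = pattern_subgroup n (R_set n P)
      in THE \<psi>. \<psi> \<in> extensional UR \<and>
           linear_character (unitri n) UR \<psi> \<and>
           (\<forall>u \<in> pattern_subgroup n (R_circ n P). \<psi> u = 1) \<and>
           (\<forall>(i, j) \<in> P. \<forall>\<alpha>. \<psi> (root_elem n i j \<alpha>) = \<theta> (A $$ (i, j) * \<alpha>)))"

definition monomial_source ::
  "('a :: {field, finite} \<Rightarrow> complex) \<Rightarrow> nat
     \<Rightarrow> 'a mat set \<Rightarrow> ('a mat \<Rightarrow> complex) \<Rightarrow> ('a mat \<Rightarrow> complex) set \<Rightarrow> bool"
where
  "monomial_source \<theta> n H \<psi> S \<longleftrightarrow>
     G_isomorphic (unitri n) (E_action \<theta> n) S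
       (induced_action (unitri n)) (induced_module (unitri n) H \<psi>)"

end

theory Submission
  imports Defs "HOL-Algebra.Coset"
begin

text \<open>
  Write \<open>H\<close> for the pattern subgroup of \<open>R_set\<close>, \<open>K\<close> for that of \<open>R_hat\<close>, and \<open>\<theta>\<^sub>A\<close> for the
  character of \<open>H\<close> given by \<open>A\<close>.  The stabilizer of \<open>[A]\<close> is \<open>H\<close>, acting on \<open>[A]\<close> by \<open>\<theta>\<^sub>A\<close>, so
  every nonzero submodule \<open>S\<close> of the orbit module contains a nonzero vector of weight \<open>\<theta>\<^sub>A\<close>.

  Let \<open>H\<^sub>t\<close> be the subgroup of \<open>H\<close> supported in the rows from \<open>t\<close> on, and let \<open>(t, j)\<close> be a main
  condition.  Translating the \<open>\<theta>\<^sub>A\<close>-weight space of \<open>H\<^sub>t\<close> by the elements supported in column \<open>j\<close>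
  at positions outside \<open>R_hat\<close> gives spaces with pairwise different \<open>H\<^sub>t\<close>-weights inside the
  \<open>\<theta>\<^sub>A\<close>-weight space of \<open>H\<^bsub>t+1\<^esub>\<close>.  By induction over the rows, \<open>dim S\<close> is at least \<open>q\<^bsup>a-b\<^esup>\<close> times
  the dimension of the \<open>\<theta>\<^sub>A\<close>-weight space of \<open>H\<close> in \<open>S\<close>; if \<open>S\<close> has minimal dimension, this
  weight space is a line.

  The group \<open>K\<close> normalizes \<open>H\<close> and fixes \<open>\<theta>\<^sub>A\<close>, so it acts on the line by a linear character
  \<open>\<lambda>\<close> extending \<open>\<theta>\<^sub>A\<close>.  Frobenius reciprocity embeds \<open>S\<close> into the module induced from \<open>\<lambda>\<close>, which
  has the same dimension \<open>q\<^bsup>a-b\<^esup>\<close>.  Finally, \<open>\<lambda>\<close> is trivial on commutators, whereas connected main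
  conditions would make \<open>\<theta>\<^sub>A\<close> nontrivial on a commutator of \<open>K\<close>.
\<close>

subsection \<open>Weights and induced modules\<close>

lemma sum_fun_apply: "(\<Sum>i\<in>I. f i) x = (\<Sum>i\<in>I. f i x :: complex)"
  by (induction I rule: infinite_finite_induct) auto

lemma cscale_apply: "cscale c f x = c * f x"
  by (simp add: cscale_def)

lemma cfun_cong_coeff:
  assumes "cscale a v = cscale b v" "v \<noteq> 0"
  shows "a = b"
  using assms by (auto simp: fun_eq_iff cscale_apply)

text \<open>Independence in the library concerns sets, so an indexed family must also be shown to
  have no repetitions: two equal members would satisfy the relation with coefficients 1 and
  -1.\<close>

lemma independent_image_family:
  fixes x :: "'i \<Rightarrow> 'x \<Rightarrow> complex"
  assumes "finite I"
    and indep: "\<And>a i. (\<Sum>i\<in>I. cscale (a i) (x i)) = 0 \<Longrightarrow> i \<in> I \<Longrightarrow> a i = 0"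
  shows "inj_on x I" "cfun.independent (x ` I)"
proof -
  show inj: "inj_on x I"
  proof (rule inj_onI, rule ccontr)
    fix i j assume ij: "i \<in> I" "j \<in> I" "x i = x j" "i \<noteq> j"
    define a :: "'i \<Rightarrow> complex" where "a = (\<lambda>k. if k = i then 1 else if k = j then - 1 else 0)"
    have "(\<Sum>k\<in>I. cscale (a k) (x k)) = (\<Sum>k\<in>{i, j}. cscale (a k) (x k))"
      using ij \<open>finite I\<close> by (intro sum.mono_neutral_right) (auto simp: a_def)
    also have "\<dots> = 0"
      using ij by (auto simp: a_def fun_eq_iff cscale_apply)
    finally have "a i = 0" using indep ij(1) by blast
    then show False by (simp add: a_def)
  qed
  show "cfun.independent (x ` I)"
  proof (rule cfun.independent_if_scalars_zero)
    fix f v assume f: "(\<Sum>v\<in>x ` I. cscale (f v) v) = 0" and v: "v \<in> x ` I"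
    have "(\<Sum>i\<in>I. cscale (f (x i)) (x i)) = 0"
      using f by (simp add: sum.reindex[OF inj])
    then show "f v = 0" using indep[of "\<lambda>i. f (x i)"] v by auto
  qed (use \<open>finite I\<close> in simp)
qed

text \<open>Take \<open>h\<close> separating \<open>d\<close> from \<open>c0\<close>. The operator
  \<open>T h\<close> minus the scalar \<open>\<chi> c0 h\<close> kills \<open>v c0\<close> and
  multiplies every other \<open>v c\<close> by a scalar that is nonzero for \<open>c = d\<close>.
  This shortens the relation, and induction applies.\<close>

lemma sum_distinct_weights_eq_zero:
  fixes v :: "'c \<Rightarrow> 'x \<Rightarrow> complex" and T :: "'h \<Rightarrow> ('x \<Rightarrow> complex) \<Rightarrow> 'x \<Rightarrow> complex"
  assumes "finite C"
    and lin: "\<And>h. h \<in> H \<Longrightarrow> Vector_Spaces.linear cscale cscale (T h)"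
    and weight: "\<And>c h. c \<in> C \<Longrightarrow> h \<in> H \<Longrightarrow> T h (v c) = cscale (\<chi> c h) (v c)"
    and distinct: "\<And>c d. c \<in> C \<Longrightarrow> d \<in> C \<Longrightarrow> c \<noteq> d \<Longrightarrow> \<exists>h\<in>H. \<chi> c h \<noteq> \<chi> d h"
    and "(\<Sum>c\<in>C. v c) = 0" "c \<in> C"
  shows "v c = 0"
  using assms(1) weight distinct assms(5,6)
proof (induction C arbitrary: v c rule: finite_induct)
  case (insert c0 C)
  have *: "v d = 0" if d: "d \<in> C" for d
  proof -
    obtain h where h: "h \<in> H" "\<chi> d h \<noteq> \<chi> c0 h"
      using insert.prems(2)[of d c0] insert.hyps d by blast
    interpret Th: Vector_Spaces.linear cscale cscale "T h" by (rule lin[OF h(1)])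
    have "T h (\<Sum>c\<in>insert c0 C. v c) = 0"
      by (simp only: insert.prems(3) Th.zero)
    then have "(\<Sum>c\<in>insert c0 C. cscale (\<chi> c h) (v c)) = 0"
      unfolding Th.sum using insert.prems(1) h(1) by simp
    moreover have "cscale (\<chi> c0 h) (\<Sum>c\<in>insert c0 C. v c) = 0"
      by (simp only: insert.prems(3) cfun.scale_zero_right)
    ultimately have 0: "(\<Sum>c\<in>C. cscale (\<chi> c h - \<chi> c0 h) (v c)) = 0"
      using insert.hyps by (simp add: cfun.scale_sum_right cfun.scale_right_distrib
          cfun.scale_left_diff_distrib sum_subtractf) (metis add_left_cancel)
    \<comment> \<open>The induction hypothesis is applied to the rescaled vectors. Some of them may
      have become zero, so only the conclusion for \<open>d\<close> is read off.\<close>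
    have "cscale (\<chi> d h - \<chi> c0 h) (v d) = 0"
    proof (rule insert.IH[where v = "\<lambda>c. cscale (\<chi> c h - \<chi> c0 h) (v c)"])
      fix c k assume "c \<in> C" "k \<in> H"
      then show "T k (cscale (\<chi> c h - \<chi> c0 h) (v c)) = cscale (\<chi> c k) (cscale (\<chi> c h - \<chi> c0 h) (v c))"
        using insert.prems(1)[of c k] lin[of k]
        by (simp add: Vector_Spaces.linear_def module_hom_def module_hom_axioms_def mult.commute)
    qed (use insert.prems(2) 0 d in auto)
    then show ?thesis using h(2) by (simp add: cfun.scale_eq_0_iff)
  qed
  then have "(\<Sum>c\<in>C. v c) = 0" by (intro sum.neutral) blast
  then have "v c0 = 0" using insert.prems(3) insert.hyps by (metis sum.insert add.right_neutral)
  then show ?case using * insert.prems(4) by auto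
qed simp

section \<open>Weight spaces of a representation of a finite group\<close>

locale right_rep = group G for G (structure) +
  fixes act :: "('x \<Rightarrow> complex) \<Rightarrow> 'a \<Rightarrow> 'x \<Rightarrow> complex" and V :: "('x \<Rightarrow> complex) set"
  assumes finite_group: "finite (carrier G)"
    and act_linear: "g \<in> carrier G \<Longrightarrow> Vector_Spaces.linear cscale cscale (\<lambda>f. act f g)"
    and submodule: "G_submodule G act V"
    and act_mult: "\<lbrakk>f \<in> V; g \<in> carrier G; h \<in> carrier G\<rbrakk> \<Longrightarrow> act (act f g) h = act f (g \<otimes> h)"
    and act_one: "f \<in> V \<Longrightarrow> act f \<one> = f"
begin

text \<open>Any function \<open>\<chi>\<close> is allowed, so that the weight of a translated vector
  can be given by a formula; a nonzero weight vector for a subgroup forces \<open>\<chi>\<close> to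
  be multiplicative there.\<close>

definition weight_space :: "'a set \<Rightarrow> ('a \<Rightarrow> complex) \<Rightarrow> ('x \<Rightarrow> complex) set" where
  "weight_space H \<chi> = {v \<in> V. \<forall>h\<in>H. act v h = cscale (\<chi> h) v}"

lemma subspace: "cfun.subspace V"
  using submodule by (simp add: G_submodule_def)

lemma act_closed: "f \<in> V \<Longrightarrow> g \<in> carrier G \<Longrightarrow> act f g \<in> V"
  using submodule by (simp add: G_submodule_def)

lemma act_add: "g \<in> carrier G \<Longrightarrow> act (f + f') g = act f g + act f' g"
  and act_scale: "g \<in> carrier G \<Longrightarrow> act (cscale c f) g = cscale c (act f g)"
  and act_zero: "g \<in> carrier G \<Longrightarrow> act 0 g = 0"
  and act_sum: "g \<in> carrier G \<Longrightarrow> act (\<Sum>i\<in>I. F i) g = (\<Sum>i\<in>I. act (F i) g)"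
proof -
  assume "g \<in> carrier G"
  then interpret l: Vector_Spaces.linear cscale cscale "\<lambda>f. act f g" by (rule act_linear)
  show "act (f + f') g = act f g + act f' g" "act (cscale c f) g = cscale c (act f g)"
    "act 0 g = 0" "act (\<Sum>i\<in>I. F i) g = (\<Sum>i\<in>I. act (F i) g)"
    by (fact l.add l.scale l.zero l.sum)+
qed

lemma act_inv_cancel: "f \<in> V \<Longrightarrow> g \<in> carrier G \<Longrightarrow> act (act f g) (inv g) = f"
  by (simp add: act_mult act_one)

lemma act_eq_0_iff: "f \<in> V \<Longrightarrow> g \<in> carrier G \<Longrightarrow> act f g = 0 \<longleftrightarrow> f = 0"
  using act_inv_cancel[of f g] act_zero[of g] act_zero[of "inv g"] by auto

text \<open>Translation by \<open>t c\<close> is linear and injective and moves \<open>W\<close>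
  into the weight space of \<open>\<chi> c\<close>. Spaces of different weights form a direct sum,
  so all translates of \<open>B\<close> together stay independent. This is the step that multiplies
  dimensions.\<close>

lemma translated_weight_vectors:
  fixes t :: "'c \<Rightarrow> 'a"
  assumes H: "H \<subseteq> carrier G" and "finite C" and t: "\<And>c. c \<in> C \<Longrightarrow> t c \<in> carrier G"
    and weight: "\<And>c b. c \<in> C \<Longrightarrow> b \<in> W \<Longrightarrow> act b (t c) \<in> weight_space H (\<chi> c)"
    and distinct: "\<And>c d. c \<in> C \<Longrightarrow> d \<in> C \<Longrightarrow> c \<noteq> d \<Longrightarrow> \<exists>h\<in>H. \<chi> c h \<noteq> \<chi> d h"
    and "W \<subseteq> V" "cfun.subspace W"
    and B: "B \<subseteq> W" "finite B" "cfun.independent B"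
  defines "B' \<equiv> (\<lambda>(c, b). act b (t c)) ` (C \<times> B)"
  shows "cfun.independent B'" "card B' = card C * card B"
proof -
  have indep: "a p = 0" if eq: "(\<Sum>p\<in>C \<times> B. cscale (a p) (case p of (c, b) \<Rightarrow> act b (t c))) = 0"
    and p: "p \<in> C \<times> B" for a p
  proof -
    obtain c b where [simp]: "p = (c, b)" and cb: "c \<in> C" "b \<in> B" using p by auto
    \<comment> \<open>\<open>w c\<close> collects the terms of the relation translated by
      \<open>t c\<close>. Distinct weights separate these parts, and independence of
      \<open>B\<close> separates the coefficients within one part.\<close>
    define w where "w c = (\<Sum>b\<in>B. cscale (a (c, b)) b)" for c
    have w: "w c \<in> W" for c
      unfolding w_def using B(1) \<open>cfun.subspace W\<close>
      by (intro cfun.subspace_sum cfun.subspace_scale) auto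
    have act_w: "act (w c) (t c) = (\<Sum>b\<in>B. cscale (a (c, b)) (act b (t c)))" if "c \<in> C" for c
      using t[OF that] by (simp add: w_def act_sum act_scale)
    have "act (w c) (t c) = 0"
    proof (rule sum_distinct_weights_eq_zero[where T = "\<lambda>h f. act f h" and H = H and \<chi> = \<chi> and C = C
          and v = "\<lambda>c. act (w c) (t c)"])
      show "(\<Sum>c\<in>C. act (w c) (t c)) = 0"
        using eq by (simp add: act_w sum.cartesian_product case_prod_unfold)
      show "act (act (w d) (t d)) h = cscale (\<chi> d h) (act (w d) (t d))" if "d \<in> C" "h \<in> H" for d h
        using weight[OF that(1) w] that(2) by (simp add: weight_space_def)
    qed (use H cb act_linear distinct \<open>finite C\<close> in auto)
    then have "w c = 0" using w[of c] \<open>W \<subseteq> V\<close> t[OF cb(1)] act_eq_0_iff by blast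
    then show "a p = 0"
      using cfun.independentD[OF B(3,2) subset_refl, of "\<lambda>b. a (c, b)" b] cb by (simp add: w_def)
  qed
  have fin: "finite (C \<times> B)" using \<open>finite C\<close> B(2) by simp
  show "cfun.independent B'"
    unfolding B'_def using indep by (intro independent_image_family(2)[OF fin]) blast
  have "inj_on (\<lambda>(c, b). act b (t c)) (C \<times> B)"
    using indep by (intro independent_image_family(1)[OF fin]) blast
  then show "card B' = card C * card B"
    by (simp add: B'_def card_image card_cartesian_product)
qed

text \<open>Up to the factor \<open>card H\<close>, the sum is the projection onto the weight space
  of \<open>\<psi>\<close>. Reindexing by \<open>k \<otimes> h\<close> handles acting by
  \<open>k\<close> before averaging, reindexing by \<open>h \<otimes> k\<close> acting after
  it.\<close>

lemma averaged_act:
  assumes H: "subgroup H G" and \<psi>: "linear_character G H \<psi>" and "f \<in> V" "k \<in> H"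
  shows "(\<Sum>h\<in>H. cscale (inverse (\<psi> h)) (act (act f k) h)) =
      cscale (\<psi> k) (\<Sum>h\<in>H. cscale (inverse (\<psi> h)) (act f h))" (is ?A)
    and "act (\<Sum>h\<in>H. cscale (inverse (\<psi> h)) (act f h)) k =
      cscale (\<psi> k) (\<Sum>h\<in>H. cscale (inverse (\<psi> h)) (act f h))" (is ?B)
proof -
  interpret H: subgroup H G by fact
  note [simp] = H.mem_carrier
  have \<psi>_mult: "\<psi> (x \<otimes> y) = \<psi> x * \<psi> y" and \<psi>_nz: "\<psi> x \<noteq> 0" if "x \<in> H" "y \<in> H" for x y
    using \<psi> that by (auto simp: linear_character_def)
  have c: "inverse (\<psi> k * x) = inverse x * inverse (\<psi> k)" for x :: complex
    by (simp add: inverse_mult_distrib mult.commute)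
  have "cscale (\<psi> k) (\<Sum>h\<in>H. cscale (inverse (\<psi> h)) (act f h)) =
      cscale (\<psi> k) (\<Sum>h\<in>H. cscale (inverse (\<psi> (k \<otimes> h))) (act f (k \<otimes> h)))"
    by (subst sum.reindex_bij_betw[where S = H and T = H and h = "\<lambda>h. k \<otimes> h", symmetric])
       (use \<open>k \<in> H\<close> in \<open>auto intro!: bij_betwI[where g = "\<lambda>h. inv k \<otimes> h"] simp: m_assoc[symmetric]\<close>)
  also have "\<dots> = (\<Sum>h\<in>H. cscale (inverse (\<psi> h)) (act (act f k) h))"
    using \<open>k \<in> H\<close> \<open>f \<in> V\<close> \<psi>_nz
    by (simp add: cfun.scale_sum_right \<psi>_mult act_mult field_simps)
  finally show ?A ..
  have "cscale (\<psi> k) (\<Sum>h\<in>H. cscale (inverse (\<psi> h)) (act f h)) =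
      cscale (\<psi> k) (\<Sum>h\<in>H. cscale (inverse (\<psi> (h \<otimes> k))) (act f (h \<otimes> k)))"
    by (subst sum.reindex_bij_betw[where S = H and T = H and h = "\<lambda>h. h \<otimes> k", symmetric])
       (use \<open>k \<in> H\<close> in \<open>auto intro!: bij_betwI[where g = "\<lambda>h. h \<otimes> inv k"] simp: m_assoc\<close>)
  also have "\<dots> = act (\<Sum>h\<in>H. cscale (inverse (\<psi> h)) (act f h)) k"
    using \<open>k \<in> H\<close> \<open>f \<in> V\<close> \<psi>_nz
    by (simp add: cfun.scale_sum_right \<psi>_mult act_mult act_sum act_scale field_simps)
  finally show ?B ..
qed

end

text \<open>One function for each right coset suffices, which bounds the dimension of the induced
  module by the index of \<open>H\<close>.\<close>

lemma (in group) induced_module_spanning_set: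
  assumes "finite (carrier G)" and H: "subgroup H G"
  obtains C where "finite C" "card C * card H \<le> Coset.order G"
    "induced_module G H \<psi> \<subseteq> cfun.span C"
proof -
  interpret H: subgroup H G by fact
  note [simp] = H.mem_carrier
  have "\<exists>r. \<forall>K\<in>rcosets H. r K \<in> carrier G \<and> K = H #> r K"
    by (intro bchoice) (auto simp: RCOSETS_def)
  then obtain r where r: "\<And>K. K \<in> rcosets H \<Longrightarrow> r K \<in> carrier G"
    "\<And>K. K \<in> rcosets H \<Longrightarrow> K = H #> r K" by blast
  \<comment> \<open>\<open>b K\<close> is supported on the left coset of \<open>H\<close> through
    \<open>inv (r K)\<close>. These supports partition the group, so \<open>f\<close> is determined
    by its values at the elements \<open>inv (r K)\<close>.\<close>
  define b where "b K = (\<lambda>x. if x \<in> carrier G \<and> r K \<otimes> x \<in> H then \<psi> (r K \<otimes> x) else 0)" for K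
  have fin: "finite (rcosets H)"
    using \<open>finite (carrier G)\<close> H.rcosets_carrier by (meson Pow_iff finite_Pow_iff finite_subset is_group subsetI)
  have "f \<in> cfun.span (b ` (rcosets H))" if f: "f \<in> induced_module G H \<psi>" for f
  proof -
    have f0: "x \<notin> carrier G \<Longrightarrow> f x = 0" and fh: "x \<in> carrier G \<Longrightarrow> h \<in> H \<Longrightarrow> f (x \<otimes> h) = f x * \<psi> h" for x h
      using f by (auto simp: induced_module_def)
    have "f = (\<Sum>K\<in>rcosets H. cscale (f (inv (r K))) (b K))"
    proof
      fix x
      show "f x = (\<Sum>K\<in>rcosets H. cscale (f (inv (r K))) (b K)) x"
      proof (cases "x \<in> carrier G")
        case x: True
        define K where "K = H #> inv x"
        have K: "K \<in> rcosets H" using x by (auto simp: K_def RCOSETS_def)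
        have iff: "r K' \<otimes> x \<in> H \<longleftrightarrow> K' = K" if K': "K' \<in> rcosets H" for K'
        proof -
          have "r K' \<otimes> x \<in> H \<longleftrightarrow> H #> r K' = H #> inv x"
            using x r(1)[OF K'] coset_join1 H by (metis H.rcos_module inv_closed inv_inv is_group rcos_self repr_independence)
          then show ?thesis using r(2)[OF K'] by (simp add: K_def)
        qed
        have "(\<Sum>K\<in>rcosets H. cscale (f (inv (r K))) (b K)) x
            = (\<Sum>K'\<in>rcosets H. if K' = K then f (inv (r K)) * \<psi> (r K \<otimes> x) else 0)"
          unfolding sum_fun_apply using iff x by (intro sum.cong) (auto simp: b_def cscale_apply)
        also have "\<dots> = f (inv (r K)) * \<psi> (r K \<otimes> x)" using K fin by simp
        also have "\<dots> = f (inv (r K) \<otimes> (r K \<otimes> x))"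
          using iff[OF K] r(1)[OF K] by (intro fh[symmetric]) auto
        also have "inv (r K) \<otimes> (r K \<otimes> x) = x" using r(1)[OF K] x by (simp add: m_assoc[symmetric])
        finally show ?thesis by simp
      qed (simp add: f0 sum_fun_apply b_def cscale_apply)
    qed
    moreover have "\<dots> \<in> cfun.span (b ` (rcosets H))"
      by (intro cfun.span_sum cfun.span_scale cfun.span_base imageI)
    ultimately show ?thesis by metis
  qed
  moreover have "card (b ` (rcosets H)) * card H \<le> Coset.order G"
    using lagrange_finite[OF assms] card_image_le[OF fin, of b] by (metis mult_le_mono1)
  ultimately show thesis using that[of "b ` (rcosets H)"] fin by blast
qed

context right_rep
begin

text \<open>Frobenius reciprocity made explicit: a linear form \<open>l\<close> with
  \<open>l (act f h) = \<psi> h * l f\<close> on \<open>V\<close> yields the homomorphism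
  \<open>\<phi>\<close>, where \<open>\<phi> f x = l (act f x)\<close>. It does not kill
  \<open>v\<close>, so irreducibility makes it injective, and the dimension makes it
  surjective.\<close>

lemma isomorphic_induced_module:
  assumes irred: "G_irreducible G act V"
    and H: "subgroup H G" and \<psi>: "linear_character G H \<psi>"
    and v: "v \<in> weight_space H \<psi>" "v \<noteq> 0"
    and dim: "cfun.dim V * card H = Coset.order G"
  shows "G_isomorphic G act V (induced_action G) (induced_module G H \<psi>)"
proof -
  interpret H: subgroup H G by fact
  note [simp] = H.mem_carrier
  obtain y where y: "v y \<noteq> 0" using v(2) by (auto simp: fun_eq_iff)
  have vV: "v \<in> V" and v_weight: "\<And>h. h \<in> H \<Longrightarrow> act v h = cscale (\<psi> h) v"
    using v(1) by (auto simp: weight_space_def)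
  have finH: "finite H" using finite_group H.subset finite_subset by blast
  \<comment> \<open>Averaging multiplies \<open>v\<close> by \<open>card H\<close>; evaluating at
    \<open>y\<close>, where \<open>v\<close> does not vanish, therefore gives
    \<open>l v \<noteq> 0\<close>.\<close>
  define l where "l f = (\<Sum>h\<in>H. cscale (inverse (\<psi> h)) (act f h)) y" for f
  define \<phi> where "\<phi> f = (\<lambda>x. if x \<in> carrier G then l (act f x) else 0)" for f
  have l_act: "l (act f k) = \<psi> k * l f" if "f \<in> V" "k \<in> H" for f k
    unfolding l_def averaged_act(1)[OF H \<psi> that] by (simp add: cscale_apply)
  have l_add: "l (f + f') = l f + l f'" and l_scale: "l (cscale c f) = c * l f" for f f' c
    by (auto simp: l_def act_add act_scale sum_fun_apply sum_distrib_left sum.distrib cscale_apply algebra_simps)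
  interpret \<phi>: Vector_Spaces.linear cscale cscale \<phi>
    by unfold_locales (auto simp: \<phi>_def fun_eq_iff cscale_apply act_add act_scale l_add l_scale)
  have "inverse (\<psi> h) * \<psi> h = 1" if "h \<in> H" for h
    using \<psi> that by (simp add: linear_character_def)
  then have "l v = (\<Sum>h\<in>H. v y)"
    unfolding l_def sum_fun_apply by (intro sum.cong) (simp_all add: v_weight cscale_apply mult.assoc[symmetric])
  moreover have cardH: "card H > 0" using finH H.one_closed by (metis card_gt_0_iff empty_iff)
  ultimately have lv: "l v \<noteq> 0" using y by auto
  have \<phi>_act: "\<phi> (act f g) = induced_action G (\<phi> f) g" if "f \<in> V" "g \<in> carrier G" for f g
    using that by (auto simp: \<phi>_def induced_action_def fun_eq_iff act_mult)
  have \<phi>_in: "\<phi> f \<in> induced_module G H \<psi>" if "f \<in> V" for f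
    using that by (auto simp: induced_module_def \<phi>_def act_mult[symmetric] l_act act_closed)
  define N where "N = {f \<in> V. \<phi> f = 0}"
  have "G_submodule G act N"
    using submodule \<phi>_act
    by (auto simp: G_submodule_def N_def cfun.subspace_def \<phi>.add \<phi>.scale \<phi>.zero induced_action_def cscale_apply fun_eq_iff)
  moreover have "\<phi> v \<one> \<noteq> 0"
    using lv act_one[OF vV] by (simp add: \<phi>_def)
  then have "v \<notin> N" by (auto simp: N_def)
  ultimately have N: "N = {0}"
    using irred vV by (auto simp: G_irreducible_def N_def)
  have inj: "inj_on \<phi> V"
    using N subspace by (auto simp: \<phi>.inj_on_iff_eq_0 N_def)
  obtain B where B: "B \<subseteq> V" "cfun.independent B" "V \<subseteq> cfun.span B" "card B = cfun.dim V"
    by (rule cfun.basis_exists)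
  have spB: "cfun.span B = V"
    using B(1,3) subspace by (metis cfun.span_subspace)
  obtain C where C: "finite C" "card C * card H \<le> Coset.order G" "induced_module G H \<psi> \<subseteq> cfun.span C"
    using induced_module_spanning_set[OF finite_group H] by blast
  have ind: "cfun.independent (\<phi> ` B)"
    using B(2) inj spB by (intro \<phi>.independent_injective_image) auto
  have CB: "card C \<le> card B" using C(2) dim B(4) cardH by (metis mult_le_cancel2)
  \<comment> \<open>Infinite sets have cardinality 0, so a positive cardinality shows that the basis
    \<open>B\<close> is finite.\<close>
  have "Coset.order G > 0" using finite_group by (simp add: order_gt_0_iff_finite)
  then have "card B > 0" using dim B(4) by (metis mult_is_0 neq0_conv)
  then have finB: "finite B" using card_gt_0_iff by blast
  have cardB: "card (\<phi> ` B) = card B"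
    using inj B(1) by (intro card_image) (auto intro: inj_on_subset)
  \<comment> \<open>A function outside the image would give \<open>Suc (card B)\<close> independent
    vectors in the span of \<open>C\<close>, which has at most \<open>card B\<close>
    elements.\<close>
  have "f \<in> \<phi> ` V" if f: "f \<in> induced_module G H \<psi>" for f
  proof (rule ccontr)
    assume "f \<notin> \<phi> ` V"
    then have nf: "f \<notin> cfun.span (\<phi> ` B)" using \<phi>.span_image[of B] spB by simp
    then have "card (insert f (\<phi> ` B)) \<le> card C"
      using C f \<phi>_in B(1) ind
      by (intro conjunct2[OF cfun.independent_span_bound] cfun.independent_insertI) auto
    moreover have "card (insert f (\<phi> ` B)) = Suc (card B)"
      using nf finB cardB cfun.span_base[of f "\<phi> ` B"] by (subst card_insert_disjoint) auto
    ultimately show False using CB by simp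
  qed
  then have "bij_betw \<phi> V (induced_module G H \<psi>)"
    using inj \<phi>_in by (auto simp: bij_betw_def)
  then show ?thesis
    unfolding G_isomorphic_def using \<phi>_act by (auto intro!: exI[of _ \<phi>] simp: \<phi>.add \<phi>.scale)
qed

end

subsection \<open>Pattern subgroups\<close>

lemma unitri_simps:
  "x \<otimes>\<^bsub>unitri n\<^esub> y = x * y" "\<one>\<^bsub>unitri n\<^esub> = 1\<^sub>m n"
  by (simp_all add: unitri_def)

lemma unitri_carrierD:
  assumes "u \<in> carrier (unitri n)"
  shows "u \<in> carrier_mat n n" "\<And>i. i < n \<Longrightarrow> u $$ (i, i) = 1"
    "\<And>i j. i < j \<Longrightarrow> j < n \<Longrightarrow> u $$ (i, j) = 0"
  using assms by (auto simp: unitri_def)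

lemma unitri_mult_carrier:
  assumes "x \<in> carrier (unitri n)" "y \<in> carrier (unitri n)"
  shows "x * y \<in> carrier (unitri n :: 'a :: field mat monoid)"
  using group.is_monoid[OF unitri_group[of n], THEN monoid.m_closed, OF assms] by (simp add: unitri_def)

lemma unitri_inv:
  fixes u :: "'a :: field mat"
  assumes "u \<in> carrier (unitri n)"
  shows "inv\<^bsub>unitri n\<^esub> u \<in> carrier (unitri n)" "inv\<^bsub>unitri n\<^esub> u * u = 1\<^sub>m n" "u * inv\<^bsub>unitri n\<^esub> u = 1\<^sub>m n"
proof -
  interpret group "unitri n :: 'a mat monoid" by (rule unitri_group)
  show "inv\<^bsub>unitri n\<^esub> u \<in> carrier (unitri n)" "inv\<^bsub>unitri n\<^esub> u * u = 1\<^sub>m n" "u * inv\<^bsub>unitri n\<^esub> u = 1\<^sub>m n"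
    using inv_closed[OF assms] l_inv[OF assms] r_inv[OF assms] by (auto simp: unitri_simps)
qed

lemma mat_mult_entry:
  assumes "X \<in> carrier_mat n n" "Y \<in> carrier_mat n n" "i < n" "j < n"
  shows "(X * Y) $$ (i, j) = (\<Sum>k<n. X $$ (i, k) * Y $$ (k, j))"
  using assms by (auto simp: scalar_prod_def lessThan_atLeast0)

lemma unitri_mult_entry:
  fixes x y :: "'a :: field mat"
  assumes "x \<in> carrier (unitri n)" "y \<in> carrier (unitri n)" "b < a" "a < n"
  shows "(x * y) $$ (a, b) = x $$ (a, b) + y $$ (a, b) + (\<Sum>c\<in>{b<..<a}. x $$ (a, c) * y $$ (c, b))"
proof -
  note x = unitri_carrierD[OF assms(1)] and y = unitri_carrierD[OF assms(2)]
  have "(x * y) $$ (a, b) = (\<Sum>c<n. x $$ (a, c) * y $$ (c, b))"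
    using x(1) y(1) assms(3,4) by (intro mat_mult_entry) auto
  also have "\<dots> = (\<Sum>c\<in>insert a (insert b {b<..<a}). x $$ (a, c) * y $$ (c, b))"
  proof (intro sum.mono_neutral_right ballI)
    fix c assume "c \<in> {..<n} - insert a (insert b {b<..<a})"
    then have "c < n" "c < b \<or> a < c" by auto
    then show "x $$ (a, c) * y $$ (c, b) = 0" using x(3)[of a c] y(3)[of c b] assms(3,4) by auto
  qed (use assms in auto)
  also have "\<dots> = x $$ (a, b) + y $$ (a, b) + (\<Sum>c\<in>{b<..<a}. x $$ (a, c) * y $$ (c, b))"
    using assms(3,4) x(2) y(2) by (simp add: algebra_simps)
  finally show ?thesis .
qed

lemma unitri_eqI:
  assumes "x \<in> carrier (unitri n)" "y \<in> carrier (unitri n)"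
    "\<And>a b. b < a \<Longrightarrow> a < n \<Longrightarrow> x $$ (a, b) = y $$ (a, b)"
  shows "x = y"
proof (rule eq_matI)
  fix a b assume "a < dim_row y" "b < dim_col y"
  then have "a < n" "b < n" using unitri_carrierD(1)[OF assms(2)] by auto
  then show "x $$ (a, b) = y $$ (a, b)"
    using unitri_carrierD[OF assms(1)] unitri_carrierD[OF assms(2)] assms(3)
    by (cases a b rule: linorder_cases) auto
qed (use unitri_carrierD(1)[OF assms(1)] unitri_carrierD(1)[OF assms(2)] in auto)

lemma pattern_subgroupD:
  assumes "u \<in> pattern_subgroup n J"
  shows "u \<in> carrier (unitri n)"
    "b < a \<Longrightarrow> a < n \<Longrightarrow> u $$ (a, b) \<noteq> 0 \<Longrightarrow> (a, b) \<in> J"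
  using assms by (auto simp: pattern_subgroup_def Phi_def)

lemma pattern_subgroup_eq_0:
  "u \<in> pattern_subgroup n J \<Longrightarrow> (a, b) \<notin> J \<Longrightarrow> b < a \<Longrightarrow> a < n \<Longrightarrow> u $$ (a, b) = 0"
  using pattern_subgroupD(2) by blast

lemma pattern_subgroupI:
  assumes "u \<in> carrier (unitri n)"
    "\<And>a b. b < a \<Longrightarrow> a < n \<Longrightarrow> u $$ (a, b) \<noteq> 0 \<Longrightarrow> (a, b) \<in> J"
  shows "u \<in> pattern_subgroup n J"
  using assms by (auto simp: pattern_subgroup_def Phi_def)

lemma pattern_subgroup_mono: "J \<subseteq> J' \<Longrightarrow> pattern_subgroup n J \<subseteq> pattern_subgroup n J'"
  by (auto simp: pattern_subgroup_def)

lemma pattern_subgroup_Phi: "pattern_subgroup n (Phi n) = carrier (unitri n)"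
  by (auto simp: pattern_subgroup_def)

text \<open>Closedness of \<open>J\<close> is \<open>products_in J J J\<close>. The form with three
  sets also expresses that mixed products fall into a smaller set, which controls
  conjugation.\<close>

definition products_in :: "(nat \<times> nat) set \<Rightarrow> (nat \<times> nat) set \<Rightarrow> (nat \<times> nat) set \<Rightarrow> bool" where
  "products_in J J' I \<longleftrightarrow> (\<forall>a b c. b < c \<longrightarrow> c < a \<longrightarrow> (a, c) \<in> J \<longrightarrow> (c, b) \<in> J' \<longrightarrow> (a, b) \<in> I)"

text \<open>\<open>y\<close> is constrained only at the entries that occur in the sum, as is
  \<open>x\<close> in the companion lemma. Both can thus be used inside inductions, before
  membership of that factor in a pattern subgroup is known.\<close>

lemma product_entries_sum_zero:
  assumes "products_in J J' I" "x \<in> pattern_subgroup n J" "(a, b) \<notin> I" "a < n"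
    and y: "\<And>c. b < c \<Longrightarrow> c < a \<Longrightarrow> y $$ (c, b) \<noteq> 0 \<Longrightarrow> (c, b) \<in> J'"
  shows "(\<Sum>c\<in>{b<..<a}. x $$ (a, c) * y $$ (c, b)) = 0"
proof (intro sum.neutral ballI)
  fix c assume "c \<in> {b<..<a}"
  then show "x $$ (a, c) * y $$ (c, b) = 0"
    using assms(1,3,4) pattern_subgroupD(2)[OF assms(2), of c a] y[of c] unfolding products_in_def
    by (metis greaterThanLessThan_iff mult_eq_0_iff)
qed

lemma product_entries_sum_zero':
  assumes "products_in J J' I" "y \<in> pattern_subgroup n J'" "(a, b) \<notin> I" "a < n"
    and x: "\<And>c. b < c \<Longrightarrow> c < a \<Longrightarrow> x $$ (a, c) \<noteq> 0 \<Longrightarrow> (a, c) \<in> J"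
  shows "(\<Sum>c\<in>{b<..<a}. x $$ (a, c) * y $$ (c, b)) = 0"
proof (intro sum.neutral ballI)
  fix c assume "c \<in> {b<..<a}"
  then show "x $$ (a, c) * y $$ (c, b) = 0"
    using assms(1,3,4) pattern_subgroupD(2)[OF assms(2), of b c] x[of c] unfolding products_in_def
    by (metis greaterThanLessThan_iff mult_eq_0_iff order.strict_trans)
qed

lemma inverse_entry:
  fixes u :: "'a :: field mat"
  assumes "u \<in> carrier (unitri n)" "b < a" "a < n"
  shows "(inv\<^bsub>unitri n\<^esub> u) $$ (a, b) =
    - u $$ (a, b) - (\<Sum>c\<in>{b<..<a}. u $$ (a, c) * (inv\<^bsub>unitri n\<^esub> u) $$ (c, b))"
proof -
  let ?v = "inv\<^bsub>unitri n\<^esub> u"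
  have "u $$ (a, b) + ?v $$ (a, b) + (\<Sum>c\<in>{b<..<a}. u $$ (a, c) * ?v $$ (c, b)) = 0"
    using unitri_mult_entry[OF assms(1) unitri_inv(1)[OF assms(1)] assms(2,3)] unitri_inv(3)[OF assms(1)]
      assms(2,3) by simp
  then show ?thesis by (simp add: algebra_simps eq_neg_iff_add_eq_0)
qed

text \<open>By \<open>inverse_entry\<close> an entry of the inverse depends on entries higher up in
  its column, so the support condition follows row by row.\<close>

lemma pattern_subgroup_inv:
  fixes u :: "'a :: field mat"
  assumes J: "products_in J J J" and u: "u \<in> pattern_subgroup n J"
  shows "inv\<^bsub>unitri n\<^esub> u \<in> pattern_subgroup n J"
proof (rule pattern_subgroupI)
  let ?v = "inv\<^bsub>unitri n\<^esub> u"
  note uc = pattern_subgroupD(1)[OF u]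
  show "?v \<in> carrier (unitri n)" by (rule unitri_inv[OF uc])
  fix a b assume "b < a" "a < n" "?v $$ (a, b) \<noteq> 0"
  then show "(a, b) \<in> J"
  proof (induction a arbitrary: b rule: less_induct)
    case (less a)
    show ?case
    proof (rule ccontr)
      assume nJ: "(a, b) \<notin> J"
      have "(\<Sum>c\<in>{b<..<a}. u $$ (a, c) * ?v $$ (c, b)) = 0"
        using less.IH less.prems by (intro product_entries_sum_zero[OF J u nJ]) auto
      then have "?v $$ (a, b) = 0"
        using inverse_entry[OF uc less.prems(1,2)] pattern_subgroup_eq_0[OF u nJ less.prems(1,2)] by simp
      then show False using less.prems by simp
    qed
  qed
qed

lemma subgroup_pattern_subgroup:
  assumes J: "products_in J J J"
  shows "subgroup (pattern_subgroup n J) (unitri n :: 'a :: field mat monoid)"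
proof (rule subgroup.intro)
  show "pattern_subgroup n J \<subseteq> carrier (unitri n :: 'a mat monoid)" by (auto simp: pattern_subgroup_def)
  show "\<one>\<^bsub>unitri n\<^esub> \<in> (pattern_subgroup n J :: 'a mat set)"
    by (auto simp: pattern_subgroup_def unitri_def Phi_def)
  fix x y :: "'a mat" assume x: "x \<in> pattern_subgroup n J" and y: "y \<in> pattern_subgroup n J"
  note xc = pattern_subgroupD(1)[OF x] and yc = pattern_subgroupD(1)[OF y]
  have "x * y \<in> pattern_subgroup n J"
  proof (rule pattern_subgroupI)
    show "x * y \<in> carrier (unitri n)" by (rule unitri_mult_carrier[OF xc yc])
    fix a b assume ab: "b < a" "a < n" "(x * y) $$ (a, b) \<noteq> 0"
    show "(a, b) \<in> J"
    proof (rule ccontr)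
      assume nJ: "(a, b) \<notin> J"
      have "(\<Sum>c\<in>{b<..<a}. x $$ (a, c) * y $$ (c, b)) = 0"
        using ab pattern_subgroupD(2)[OF y] by (intro product_entries_sum_zero[OF J x nJ]) auto
      then show False
        using unitri_mult_entry[OF xc yc ab(1,2)] ab pattern_subgroup_eq_0[OF x nJ ab(1,2)]
          pattern_subgroup_eq_0[OF y nJ ab(1,2)] by simp
    qed
  qed
  then show "x \<otimes>\<^bsub>unitri n\<^esub> y \<in> pattern_subgroup n J" by (simp add: unitri_def)
next
  fix x :: "'a mat" assume "x \<in> pattern_subgroup n J"
  then show "inv\<^bsub>unitri n\<^esub> x \<in> pattern_subgroup n J" by (rule pattern_subgroup_inv[OF J])
qed

text \<open>\<open>u'\<close> is the conjugate of \<open>u\<close> by \<open>x\<close>. Comparing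
  entries of \<open>x * u\<close> and \<open>u' * x\<close> gives a recursion along each row, from
  the diagonal to the left, without entries of the inverse.\<close>

lemma conjugate_exists:
  fixes x u :: "'a :: field mat"
  assumes "x \<in> carrier (unitri n)" "u \<in> carrier (unitri n)"
  obtains u' where "u' \<in> carrier (unitri n)" "x * u = u' * x"
    "\<And>a b. b < a \<Longrightarrow> a < n \<Longrightarrow> u' $$ (a, b) = u $$ (a, b)
      + (\<Sum>c\<in>{b<..<a}. x $$ (a, c) * u $$ (c, b)) - (\<Sum>c\<in>{b<..<a}. u' $$ (a, c) * x $$ (c, b))"
proof -
  define u' where "u' = x * u * inv\<^bsub>unitri n\<^esub> x"
  have xi: "inv\<^bsub>unitri n\<^esub> x \<in> carrier (unitri n)" by (rule unitri_inv[OF assms(1)])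
  have u': "u' \<in> carrier (unitri n)"
    unfolding u'_def by (intro unitri_mult_carrier assms xi)
  have eq: "x * u = u' * x"
    using unitri_carrierD(1)[OF assms(1)] unitri_carrierD(1)[OF assms(2)] unitri_carrierD(1)[OF xi]
    by (simp add: u'_def unitri_inv(2)[OF assms(1)] assoc_mult_mat[of _ n n _ n _ n])
  show thesis
  proof (rule that[OF u' eq])
    fix a b assume "b < a" "a < n"
    then show "u' $$ (a, b) = u $$ (a, b)
      + (\<Sum>c\<in>{b<..<a}. x $$ (a, c) * u $$ (c, b)) - (\<Sum>c\<in>{b<..<a}. u' $$ (a, c) * x $$ (c, b))"
      using unitri_mult_entry[OF assms, of b a] unitri_mult_entry[OF u' assms(1), of b a] eq
      by (simp add: algebra_simps)
  qed
qed

text \<open>Outside \<open>I\<^sub>0\<close> both correction sums of the recursion for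
  \<open>u'\<close> vanish, by induction on the distance from the diagonal. Hence \<open>x\<close>
  normalizes the pattern subgroup of \<open>I\<close> and changes entries only inside
  \<open>I\<^sub>0\<close>.\<close>

lemma pattern_subgroup_conjugate:
  fixes x u :: "'a :: field mat"
  assumes prod: "products_in J I I\<^sub>0" "products_in I J I\<^sub>0" and "I\<^sub>0 \<subseteq> I"
    and x: "x \<in> pattern_subgroup n J" and u: "u \<in> pattern_subgroup n I"
  obtains u' where "u' \<in> pattern_subgroup n I" "x * u = u' * x"
    "\<And>a b. b < a \<Longrightarrow> a < n \<Longrightarrow> (a, b) \<notin> I\<^sub>0 \<Longrightarrow> u' $$ (a, b) = u $$ (a, b)"
proof -
  obtain u' where u': "u' \<in> carrier (unitri n)" "x * u = u' * x"
    "\<And>a b. b < a \<Longrightarrow> a < n \<Longrightarrow> u' $$ (a, b) = u $$ (a, b)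
      + (\<Sum>c\<in>{b<..<a}. x $$ (a, c) * u $$ (c, b)) - (\<Sum>c\<in>{b<..<a}. u' $$ (a, c) * x $$ (c, b))"
    using conjugate_exists[OF pattern_subgroupD(1)[OF x] pattern_subgroupD(1)[OF u]] by blast
  have same_and_mem: "((a, b) \<notin> I\<^sub>0 \<longrightarrow> u' $$ (a, b) = u $$ (a, b)) \<and> (u' $$ (a, b) \<noteq> 0 \<longrightarrow> (a, b) \<in> I)"
    if "b < a" "a < n" for a b
    using that
  proof (induction "a - b" arbitrary: b rule: less_induct)
    case less
    have "u' $$ (a, b) = u $$ (a, b)" if n0: "(a, b) \<notin> I\<^sub>0"
    proof -
      have "(\<Sum>c\<in>{b<..<a}. x $$ (a, c) * u $$ (c, b)) = 0"
        using less.prems pattern_subgroupD(2)[OF u] by (intro product_entries_sum_zero[OF prod(1) x n0]) auto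
      moreover have "(\<Sum>c\<in>{b<..<a}. u' $$ (a, c) * x $$ (c, b)) = 0"
        using less.prems less.hyps by (intro product_entries_sum_zero'[OF prod(2) x n0]) auto
      ultimately show ?thesis using u'(3)[OF less.prems] by simp
    qed
    then show ?case using pattern_subgroupD(2)[OF u less.prems] \<open>I\<^sub>0 \<subseteq> I\<close> by (metis subsetD)
  qed
  show thesis
    using same_and_mem by (intro that[OF pattern_subgroupI[OF u'(1)] u'(2)]) blast+
qed

lemma card_pattern_subgroup:
  assumes "J \<subseteq> Phi n"
  shows "card (pattern_subgroup n J :: 'a :: {field, finite} mat set) = card (UNIV :: 'a set) ^ card J"
proof -
  have finJ: "finite J" using assms finite_subset[of J "{..<n} \<times> {..<n}"] by (force simp: Phi_def)
  define m where "m f = mat n n (\<lambda>(a, b). if a = b then 1 else if (a, b) \<in> J then f (a, b) else (0 :: 'a))" for f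
  have m_entry: "m f $$ (a, b) = (if a = b then 1 else if (a, b) \<in> J then f (a, b) else 0)"
    if "a < n" "b < n" for f a b using that by (simp add: m_def)
  have m_in: "m f \<in> pattern_subgroup n J" for f
    using assms by (intro pattern_subgroupI) (auto simp: unitri_def m_entry Phi_def m_def split: if_splits)
  have "bij_betw m (J \<rightarrow>\<^sub>E UNIV) (pattern_subgroup n J)"
  proof (rule bij_betwI[where g = "\<lambda>u. restrict (\<lambda>p. u $$ p) J"])
    show "restrict (\<lambda>p. m f $$ p) J = f" if f: "f \<in> J \<rightarrow>\<^sub>E UNIV" for f
    proof
      fix p show "restrict (\<lambda>p. m f $$ p) J p = f p"
        using f assms by (cases p) (auto simp: m_entry Phi_def PiE_def extensional_def)
    qed
    show "m (restrict (\<lambda>p. u $$ p) J) = u" if u: "u \<in> pattern_subgroup n J" for u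
      using pattern_subgroupD[OF u]
      by (intro unitri_eqI[OF pattern_subgroupD(1)[OF m_in] pattern_subgroupD(1)[OF u]]) (auto simp: m_entry)
  qed (use m_in in auto)
  then have "card (pattern_subgroup n J :: 'a mat set) = card (J \<rightarrow>\<^sub>E (UNIV :: 'a set))"
    by (simp add: bij_betw_same_card)
  then show ?thesis by (simp add: card_PiE finJ)
qed

lemma finite_unitri: "finite (carrier (unitri n :: 'a :: {field, finite} mat monoid))"
proof -
  have "card (carrier (unitri n :: 'a mat monoid)) = card (UNIV :: 'a set) ^ card (Phi n)"
    using card_pattern_subgroup[of "Phi n" n] by (simp add: pattern_subgroup_Phi)
  then have "card (carrier (unitri n :: 'a mat monoid)) > 0" by (simp add: finite_UNIV_card_ge_0)
  then show ?thesis by (rule card_ge_0_finite)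
qed

lemma root_elem_entry:
  assumes "a < n" "b < n"
  shows "root_elem n i j \<alpha> $$ (a, b) = (if a = b then 1 else 0) + (if a = i \<and> b = j then \<alpha> else 0)"
  using assms by (auto simp: root_elem_def)

lemma root_elem_in_pattern_subgroup:
  assumes "(i, j) \<in> J" "j < i"
  shows "root_elem n i j \<alpha> \<in> pattern_subgroup n J"
proof (rule pattern_subgroupI)
  have "root_elem n i j \<alpha> \<in> carrier_mat n n" by (simp add: root_elem_def)
  then show "root_elem n i j \<alpha> \<in> carrier (unitri n)"
    using assms by (auto simp: unitri_def root_elem_entry)
qed (use assms in \<open>auto simp: root_elem_entry split: if_splits\<close>)

subsection \<open>The monomial module\<close>

text \<open>The space with basis all \<open>[B]\<close>, as a subspace of the functions on all
  matrices. The identity matrix acts as the projection onto it, so it acts trivially only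
  here.\<close>

definition supported :: "nat \<Rightarrow> ('a :: {field, finite} mat \<Rightarrow> complex) set" where
  "supported n = {f. \<forall>B. B \<notin> strict_lower n \<longrightarrow> f B = 0}"

section \<open>The action on strictly lower triangular matrices\<close>

lemma E_dot_in_strict_lower [simp]: "E_dot n A u \<in> strict_lower n"
  by (auto simp: E_dot_def lower_part_def strict_lower_def)

lemma strict_lower_eqI:
  assumes "A \<in> strict_lower n" "B \<in> strict_lower n"
    "\<And>a b. b < a \<Longrightarrow> a < n \<Longrightarrow> A $$ (a, b) = B $$ (a, b)"
  shows "A = B"
proof (rule eq_matI)
  fix a b assume "a < dim_row B" "b < dim_col B"
  then show "A $$ (a, b) = B $$ (a, b)"
    using assms by (cases "b < a") (auto simp: strict_lower_def)
qed (use assms in \<open>auto simp: strict_lower_def\<close>)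

lemma E_dot_entry:
  fixes u :: "'a :: field mat"
  assumes "A \<in> strict_lower n" "u \<in> carrier (unitri n)" "b < a" "a < n"
  shows "E_dot n A u $$ (a, b) = (\<Sum>k<n. A $$ (a, k) * (inv\<^bsub>unitri n\<^esub> u) $$ (b, k))"
proof -
  have A: "A \<in> carrier_mat n n" using assms(1) by (simp add: strict_lower_def)
  have u: "inv\<^bsub>unitri n\<^esub> u \<in> carrier_mat n n" by (rule unitri_carrierD(1)[OF unitri_inv(1)[OF assms(2)]])
  have "E_dot n A u $$ (a, b) = (A * transpose_mat (inv\<^bsub>unitri n\<^esub> u)) $$ (a, b)"
    using assms(3,4) by (simp add: E_dot_def lower_part_def)
  also have "\<dots> = (\<Sum>k<n. A $$ (a, k) * transpose_mat (inv\<^bsub>unitri n\<^esub> u) $$ (k, b))"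
    using A u assms(3,4) by (intro mat_mult_entry) auto
  also have "\<dots> = (\<Sum>k<n. A $$ (a, k) * (inv\<^bsub>unitri n\<^esub> u) $$ (b, k))"
    using u assms(3,4) by (intro sum.cong) auto
  finally show ?thesis .
qed

lemma unitri_inv_mult:
  fixes u v :: "'a :: field mat"
  assumes "u \<in> carrier (unitri n)" "v \<in> carrier (unitri n)"
  shows "inv\<^bsub>unitri n\<^esub> (u * v) = inv\<^bsub>unitri n\<^esub> v * inv\<^bsub>unitri n\<^esub> u"
  using group.inv_mult_group[OF unitri_group assms] by (simp add: unitri_simps)

text \<open>Truncating after the first step does no harm: a truncated entry \<open>(a, k)\<close>
  has \<open>a \<le> k\<close>, hence \<open>b < k\<close>, and row \<open>b\<close> of the second
  inverse vanishes to the right of the diagonal.\<close>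

lemma E_dot_mult:
  fixes u v :: "'a :: field mat"
  assumes A: "A \<in> strict_lower n" and u: "u \<in> carrier (unitri n)" and v: "v \<in> carrier (unitri n)"
  shows "E_dot n (E_dot n A u) v = E_dot n A (u * v)"
proof (rule strict_lower_eqI)
  let ?u = "inv\<^bsub>unitri n\<^esub> u" and ?v = "inv\<^bsub>unitri n\<^esub> v"
  note uc = unitri_inv(1)[OF u] and vc = unitri_inv(1)[OF v]
  fix a b assume ab: "b < a" "a < n"
  have "E_dot n (E_dot n A u) v $$ (a, b) = (\<Sum>k<n. (\<Sum>m<n. A $$ (a, m) * ?u $$ (k, m)) * ?v $$ (b, k))"
    unfolding E_dot_entry[OF E_dot_in_strict_lower v ab]
  proof (intro sum.cong refl)
    fix k assume "k \<in> {..<n}"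
    then show "E_dot n A u $$ (a, k) * ?v $$ (b, k) = (\<Sum>m<n. A $$ (a, m) * ?u $$ (k, m)) * ?v $$ (b, k)"
      using E_dot_entry[OF A u, of k a] unitri_carrierD(3)[OF vc, of b k] ab by (cases "k < a") auto
  qed
  also have "\<dots> = (\<Sum>m<n. A $$ (a, m) * (\<Sum>k<n. ?v $$ (b, k) * ?u $$ (k, m)))"
    unfolding sum_distrib_left sum_distrib_right by (subst sum.swap) (simp add: mult_ac)
  also have "\<dots> = (\<Sum>m<n. A $$ (a, m) * (?v * ?u) $$ (b, m))"
    using ab unitri_carrierD(1)[OF uc] unitri_carrierD(1)[OF vc]
    by (intro sum.cong refl arg_cong2[where f = "(*)"] mat_mult_entry[symmetric]) auto
  also have "\<dots> = E_dot n A (u * v) $$ (a, b)"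
    by (simp add: E_dot_entry[OF A unitri_mult_carrier[OF u v] ab] unitri_inv_mult[OF u v])
  finally show "E_dot n (E_dot n A u) v $$ (a, b) = E_dot n A (u * v) $$ (a, b)" .
qed simp_all

lemma unitri_inv_one [simp]: "inv\<^bsub>unitri n\<^esub> (1\<^sub>m n) = (1\<^sub>m n :: 'a :: field mat)"
  using monoid.inv_one[OF group.is_monoid[OF unitri_group]] by (metis unitri_simps(2))

lemma one_in_unitri [simp]: "1\<^sub>m n \<in> carrier (unitri n)"
  by (simp add: unitri_def)

lemma E_dot_one:
  assumes A: "A \<in> strict_lower n"
  shows "E_dot n A (1\<^sub>m n) = (A :: 'a :: field mat)"
proof (rule strict_lower_eqI[OF E_dot_in_strict_lower A])
  fix a b assume ab: "b < a" "a < n"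
  have "E_dot n A (1\<^sub>m n) $$ (a, b) = (\<Sum>k<n. if k = b then A $$ (a, k) else 0)"
    unfolding E_dot_entry[OF A one_in_unitri ab] unitri_inv_one using ab by (intro sum.cong) auto
  then show "E_dot n A (1\<^sub>m n) $$ (a, b) = A $$ (a, b)" using ab by simp
qed

lemma E_dot_inv_cancel:
  fixes u :: "'a :: field mat"
  assumes "A \<in> strict_lower n" "u \<in> carrier (unitri n)"
  shows "E_dot n (E_dot n A u) (inv\<^bsub>unitri n\<^esub> u) = A" "E_dot n (E_dot n A (inv\<^bsub>unitri n\<^esub> u)) u = A"
  using assms by (simp_all add: E_dot_mult unitri_inv E_dot_one)

text \<open>With \<open>u'\<close>, \<open>v'\<close> the inverses,
  \<open>1 - v' u' = (1 - u') + (1 - v') u'\<close>. In the last term \<open>u'\<close> moves to the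
  other argument of the trace form, turning \<open>A\<close> into \<open>A\<close> times the
  transpose of \<open>u'\<close>; truncation is harmless because \<open>1 - v'\<close> is strictly
  lower triangular.\<close>

lemma chi_cocycle:
  fixes u v :: "'a :: field mat"
  assumes \<theta>: "\<And>x y. \<theta> (x + y) = \<theta> x * \<theta> y"
    and A: "A \<in> strict_lower n" and u: "u \<in> carrier (unitri n)" and v: "v \<in> carrier (unitri n)"
  shows "chi \<theta> n A (1\<^sub>m n - inv\<^bsub>unitri n\<^esub> u) * chi \<theta> n (E_dot n A u) (1\<^sub>m n - inv\<^bsub>unitri n\<^esub> v)
    = chi \<theta> n A (1\<^sub>m n - inv\<^bsub>unitri n\<^esub> (u * v))"
proof -
  let ?u = "inv\<^bsub>unitri n\<^esub> u" and ?v = "inv\<^bsub>unitri n\<^esub> v"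
  note uc = unitri_inv(1)[OF u] and vc = unitri_inv(1)[OF v]
  have carr: "?u \<in> carrier_mat n n" "?v \<in> carrier_mat n n"
    by (rule unitri_carrierD(1)[OF uc], rule unitri_carrierD(1)[OF vc])
  have *: "(\<Sum>j<n. E_dot n A u $$ (i, j) * (1\<^sub>m n - ?v) $$ (i, j))
      = (\<Sum>k<n. A $$ (i, k) * (?u - ?v * ?u) $$ (i, k))" if i: "i < n" for i
  proof -
    have "(\<Sum>j<n. E_dot n A u $$ (i, j) * (1\<^sub>m n - ?v) $$ (i, j))
        = (\<Sum>j<n. (\<Sum>k<n. A $$ (i, k) * ?u $$ (j, k)) * (1\<^sub>m n - ?v) $$ (i, j))"
    proof (intro sum.cong refl)
      fix j assume j: "j \<in> {..<n}"
      show "E_dot n A u $$ (i, j) * (1\<^sub>m n - ?v) $$ (i, j)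
          = (\<Sum>k<n. A $$ (i, k) * ?u $$ (j, k)) * (1\<^sub>m n - ?v) $$ (i, j)"
      proof (cases "j < i")
        case False
        then have "(1\<^sub>m n - ?v) $$ (i, j) = 0"
          using unitri_carrierD(2)[OF vc i] unitri_carrierD(3)[OF vc, of i j] i j carr
          by (cases "i = j") auto
        then show ?thesis by simp
      qed (use E_dot_entry[OF A u, of j i] i in simp)
    qed
    also have "\<dots> = (\<Sum>k<n. A $$ (i, k) * (\<Sum>j<n. (1\<^sub>m n - ?v) $$ (i, j) * ?u $$ (j, k)))"
      unfolding sum_distrib_left sum_distrib_right by (subst sum.swap) (simp add: mult_ac)
    also have "\<dots> = (\<Sum>k<n. A $$ (i, k) * ((1\<^sub>m n - ?v) * ?u) $$ (i, k))"
      using i carr by (intro sum.cong refl arg_cong2[where f = "(*)"] mat_mult_entry[symmetric]) auto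
    also have "(1\<^sub>m n - ?v) * ?u = ?u - ?v * ?u"
      using carr by (simp add: minus_mult_distrib_mat[of _ n n])
    finally show ?thesis .
  qed
  have "(\<Sum>i<n. \<Sum>j<n. A $$ (i, j) * (1\<^sub>m n - ?u) $$ (i, j)) + (\<Sum>i<n. \<Sum>j<n. E_dot n A u $$ (i, j) * (1\<^sub>m n - ?v) $$ (i, j))
      = (\<Sum>i<n. \<Sum>j<n. A $$ (i, j) * (1\<^sub>m n - ?u) $$ (i, j) + A $$ (i, j) * (?u - ?v * ?u) $$ (i, j))"
    by (simp add: * sum.distrib)
  also have "\<dots> = (\<Sum>i<n. \<Sum>j<n. A $$ (i, j) * (1\<^sub>m n - ?v * ?u) $$ (i, j))"
    using carr by (intro sum.cong refl) (simp add: algebra_simps del: index_mult_mat(1))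
  finally have "(\<Sum>i<n. \<Sum>j<n. A $$ (i, j) * (1\<^sub>m n - ?u) $$ (i, j)) + (\<Sum>i<n. \<Sum>j<n. E_dot n A u $$ (i, j) * (1\<^sub>m n - ?v) $$ (i, j))
      = (\<Sum>i<n. \<Sum>j<n. A $$ (i, j) * (1\<^sub>m n - ?v * ?u) $$ (i, j))" .
  then show ?thesis
    unfolding chi_def unitri_inv_mult[OF u v] by (metis \<theta>)
qed

section \<open>Linear extension to functions on matrices\<close>

lemma E_action_apply:
  "E_action \<theta> n f u C =
    (\<Sum>B\<in>strict_lower n. if C = E_dot n B u then f B * chi \<theta> n B (1\<^sub>m n - inv\<^bsub>unitri n\<^esub> u) else 0)"
  unfolding E_action_def sum_fun_apply by (intro sum.cong) (auto simp: cscale_apply basis_fun_def)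

lemma linear_E_action: "Vector_Spaces.linear cscale cscale (\<lambda>f. E_action \<theta> n f u)"
  by unfold_locales
    (auto simp: E_action_apply cscale_apply fun_eq_iff sum.distrib[symmetric] sum_distrib_left algebra_simps
       intro!: sum.cong)

text \<open>The map \<open>E_dot\<close> with fixed \<open>u\<close> permutes the strictly lower
  triangular matrices, so a single summand contributes.\<close>

lemma E_action_E_dot:
  assumes B: "B \<in> strict_lower n" and u: "u \<in> carrier (unitri n)"
  shows "E_action \<theta> n f u (E_dot n B u) = f B * chi \<theta> n B (1\<^sub>m n - inv\<^bsub>unitri n\<^esub> u)"
proof -
  have "E_dot n B u = E_dot n C u \<longleftrightarrow> C = B" if "C \<in> strict_lower n" for C
    using E_dot_inv_cancel(1)[OF B u] E_dot_inv_cancel(1)[OF that u] by metis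
  then have "E_action \<theta> n f u (E_dot n B u) =
      (\<Sum>C\<in>strict_lower n. if C = B then f C * chi \<theta> n C (1\<^sub>m n - inv\<^bsub>unitri n\<^esub> u) else 0)"
    unfolding E_action_apply by (intro sum.cong) auto
  then show ?thesis using B by (simp add: finite_strict_lower)
qed

lemma E_action_supported: "E_action \<theta> n f u \<in> supported n"
  by (auto simp: supported_def E_action_apply intro!: sum.neutral)

lemma supported_eqI:
  assumes "f \<in> supported n" "g \<in> supported n" "\<And>B. B \<in> strict_lower n \<Longrightarrow> f B = g B"
  shows "f = g"
proof
  fix B show "f B = g B" using assms by (cases "B \<in> strict_lower n") (auto simp: supported_def)
qed

lemma E_action_mult:
  assumes \<theta>: "\<And>x y. \<theta> (x + y) = \<theta> x * \<theta> y"
    and u: "u \<in> carrier (unitri n)" and v: "v \<in> carrier (unitri n)"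
  shows "E_action \<theta> n (E_action \<theta> n f u) v = E_action \<theta> n f (u * v)"
proof (rule supported_eqI[OF E_action_supported E_action_supported])
  fix C :: "'a mat" assume "C \<in> strict_lower n"
  then obtain B where B: "B \<in> strict_lower n" and C: "C = E_dot n B (u * v)"
    using E_dot_inv_cancel(2)[OF _ unitri_mult_carrier[OF u v]] E_dot_in_strict_lower by metis
  have "E_action \<theta> n (E_action \<theta> n f u) v C
      = f B * (chi \<theta> n B (1\<^sub>m n - inv\<^bsub>unitri n\<^esub> u) * chi \<theta> n (E_dot n B u) (1\<^sub>m n - inv\<^bsub>unitri n\<^esub> v))"
    unfolding C by (simp flip: E_dot_mult[OF B u v] add: E_action_E_dot B u v)
  also have "\<dots> = E_action \<theta> n f (u * v) C"
    unfolding chi_cocycle[OF \<theta> B u v] C by (simp add: E_action_E_dot B unitri_mult_carrier u v)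
  finally show "E_action \<theta> n (E_action \<theta> n f u) v C = E_action \<theta> n f (u * v) C" .
qed

lemma E_action_one:
  assumes "\<theta> 0 = 1" "f \<in> supported n"
  shows "E_action \<theta> n f (1\<^sub>m n) = f"
proof (rule supported_eqI[OF E_action_supported assms(2)])
  fix B :: "'a mat" assume B: "B \<in> strict_lower n"
  have "chi \<theta> n B (1\<^sub>m n - 1\<^sub>m n) = 1" by (simp add: chi_def assms(1))
  then show "E_action \<theta> n f (1\<^sub>m n) B = f B"
    using E_action_E_dot[OF B one_in_unitri, of \<theta> f] by (simp add: E_dot_one[OF B])
qed

lemma orbit_module_subset: "orbit_module n A \<subseteq> {f. \<forall>B. B \<notin> E_dot n A ` carrier (unitri n) \<longrightarrow> f B = 0}"
  unfolding orbit_module_def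
  by (rule cfun.span_minimal) (auto simp: orbit_r_def basis_fun_def cfun.subspace_def cscale_apply)

subsection \<open>Main conditions and closed sets\<close>

locale rook_placement =
  fixes n :: nat and P :: "(nat \<times> nat) set"
  assumes subset_Phi: "P \<subseteq> Phi n"
    and row_unique: "(i, j) \<in> P \<Longrightarrow> (i, k) \<in> P \<Longrightarrow> j = k"
    and column_unique: "(i, j) \<in> P \<Longrightarrow> (k, j) \<in> P \<Longrightarrow> i = k"
begin

abbreviation R where "R \<equiv> R_set n P"
abbreviation Rc where "Rc \<equiv> R_circ n P"
abbreviation Rh where "Rh \<equiv> R_hat n P"

lemma memD: "(i, j) \<in> P \<Longrightarrow> j < i \<and> i < n"
  using subset_Phi by (auto simp: Phi_def)

text \<open>Quantifying over the main conditions of column \<open>b\<close> treats columns with and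
  without a main condition alike, so that closedness becomes a matter of inequalities.\<close>

lemma R_iff: "(a, b) \<in> R \<longleftrightarrow> b < a \<and> a < n \<and> (\<forall>i. (i, b) \<in> P \<longrightarrow> i \<le> a)"
proof -
  have "(\<exists>i. (i, b) \<in> P \<and> i \<le> a \<and> a < n) \<longleftrightarrow> (\<exists>i. (i, b) \<in> P) \<and> b < a \<and> a < n \<and> (\<forall>i. (i, b) \<in> P \<longrightarrow> i \<le> a)"
    using memD column_unique by (metis order.strict_trans2)
  moreover have "b \<in> snd ` P \<longleftrightarrow> (\<exists>i. (i, b) \<in> P)" by force
  ultimately show ?thesis by (auto simp: R_set_def Phi_def)
qed

lemma Rh_iff:
  "(a, b) \<in> Rh \<longleftrightarrow> b < a \<and> a < n \<and> (\<forall>i. (i, b) \<in> P \<longrightarrow> i \<le> a \<or> (\<exists>r. (r, a) \<in> P \<and> i < r))"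
proof
  assume "(a, b) \<in> Rh"
  then show "b < a \<and> a < n \<and> (\<forall>i. (i, b) \<in> P \<longrightarrow> i \<le> a \<or> (\<exists>r. (r, a) \<in> P \<and> i < r))"
    using column_unique unfolding R_hat_def by (auto simp: R_iff Phi_def)
next
  assume *: "b < a \<and> a < n \<and> (\<forall>i. (i, b) \<in> P \<longrightarrow> i \<le> a \<or> (\<exists>r. (r, a) \<in> P \<and> i < r))"
  show "(a, b) \<in> Rh"
  proof (cases "(a, b) \<in> R")
    case False
    then obtain i where "(i, b) \<in> P" "a < i" using * by (auto simp: R_iff not_le)
    moreover from this * obtain r where "(r, a) \<in> P" "i < r" by (metis not_le)
    ultimately show ?thesis using * memD[of r a] unfolding R_hat_def Phi_def by blast
  qed (simp add: R_hat_def)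
qed

lemma Rc_iff: "(a, b) \<in> Rc \<longleftrightarrow> b < a \<and> a < n \<and> (\<forall>i. (i, b) \<in> P \<longrightarrow> i < a)"
proof -
  have "(a, b) \<in> P \<and> (i, b) \<in> P \<longrightarrow> i = a" for i using column_unique by blast
  then show ?thesis unfolding R_circ_def Diff_iff R_iff by (metis le_less less_irrefl)
qed

lemma Rc_subset_R: "Rc \<subseteq> R" and R_subset_Rh: "R \<subseteq> Rh" and Rh_subset_Phi: "Rh \<subseteq> Phi n"
  by (auto simp: R_circ_def R_hat_def R_iff Phi_def)

lemma P_subset_R: "P \<subseteq> R"
  using column_unique memD by (auto simp: R_iff) (metis le_refl)

text \<open>A main condition \<open>(i, b)\<close> satisfies \<open>i \<le> c < a\<close>. Together
  with \<open>products_R_Rh\<close> this says that the pattern subgroup of \<open>Rh\<close>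
  normalizes that of \<open>R\<close> and acts trivially modulo that of \<open>Rc\<close>.\<close>

lemma products_Rh_R: "products_in Rh R Rc"
  unfolding products_in_def
proof (intro allI impI)
  fix a b c assume "b < c" "c < a" "(a, c) \<in> Rh" "(c, b) \<in> R"
  then show "(a, b) \<in> Rc" unfolding R_iff Rh_iff Rc_iff by auto
qed

text \<open>If a main condition \<open>(i, b)\<close> has \<open>i > c\<close>, then
  \<open>(c, b)\<close> in \<open>Rh\<close> supplies a main condition \<open>(r, c)\<close> with
  \<open>i < r\<close>, and \<open>(a, c)\<close> in \<open>R\<close> forces
  \<open>r \<le> a\<close>.\<close>

lemma products_R_Rh: "products_in R Rh Rc"
  unfolding products_in_def
proof (intro allI impI)
  fix a b c assume *: "b < c" "c < a" "(a, c) \<in> R" "(c, b) \<in> Rh"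
  have "i < a" if "(i, b) \<in> P" for i
  proof (cases "i \<le> c")
    case False
    with * that obtain r where "(r, c) \<in> P" "i < r" unfolding Rh_iff by blast
    moreover have "r \<le> a" using * \<open>(r, c) \<in> P\<close> unfolding R_iff by blast
    ultimately show ?thesis by simp
  qed (use * in simp)
  then show "(a, b) \<in> Rc" using * unfolding R_iff Rc_iff by auto
qed

lemma products_Rh_Rh: "products_in Rh Rh Rh"
  unfolding products_in_def
proof (intro allI impI)
  fix a b c assume *: "b < c" "c < a" "(a, c) \<in> Rh" "(c, b) \<in> Rh"
  have "i \<le> a \<or> (\<exists>r. (r, a) \<in> P \<and> i < r)" if "(i, b) \<in> P" for i
  proof (cases "i \<le> c")
    case False
    with * that obtain r where r: "(r, c) \<in> P" "i < r" unfolding Rh_iff by blast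
    with * have "r \<le> a \<or> (\<exists>r'. (r', a) \<in> P \<and> r < r')" unfolding Rh_iff by blast
    then show ?thesis using r(2) by (auto intro: order.strict_trans)
  qed (use * in simp)
  then show "(a, b) \<in> Rh" using * unfolding Rh_iff by auto
qed

lemma products_R_R: "products_in R R Rc"
  using products_Rh_R R_subset_Rh unfolding products_in_def by (meson subsetD)

lemma products_R: "products_in R R R"
  using products_R_R Rc_subset_R unfolding products_in_def by (meson subsetD)

section \<open>Hook intersections and the exponent of the minimal dimension\<close>

lemma hooks_meet_iff:
  assumes "(i, j) \<in> P" "(r, s) \<in> P" "(i, j) \<noteq> (r, s)"
  shows "x \<in> hook (i, j) \<inter> hook (r, s) \<longleftrightarrow>
    j < s \<and> s < i \<and> i < r \<and> x = (i, s) \<or> s < j \<and> j < r \<and> r < i \<and> x = (r, j)"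
proof -
  have "i \<noteq> r" "j \<noteq> s" using assms row_unique column_unique by auto
  then show ?thesis using memD[OF assms(1)] memD[OF assms(2)] by (cases x) (auto simp: hook_def)
qed

lemma finite_P: "finite P"
  using subset_Phi by (rule finite_subset) (rule finite_subset[of _ "{..<n} \<times> {..<n}"], auto simp: Phi_def)

text \<open>\<open>X\<close> lists the non-corner positions \<open>(i, k)\<close> on the row parts
  of the hooks, so it has \<open>a_number P\<close> elements. Those that are hook intersections form
  \<open>Y\<close>, with \<open>b_number P\<close> elements. Reflecting the remaining ones from the
  row part to the column part of their hook gives exactly the positions outside
  \<open>Rh\<close>.\<close>

lemma card_Phi_minus_Rh: "card (Phi n - Rh) = a_number P - b_number P"
proof -
  define X where "X = (SIGMA p:P. {snd p<..<fst p})"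
  define Y where "Y = {((i, j), k) \<in> X. \<exists>r. (r, k) \<in> P \<and> i < r}"
  have memY: "((i, j), k) \<in> Y \<longleftrightarrow> (i, j) \<in> P \<and> j < k \<and> k < i \<and> (\<exists>r. (r, k) \<in> P \<and> i < r)"
    and memX: "((i, j), k) \<in> X \<longleftrightarrow> (i, j) \<in> P \<and> j < k \<and> k < i" for i j k
    by (simp_all add: X_def Y_def)
  have finX: "finite X" using finite_P by (auto simp: X_def)
  have "Y \<subseteq> X" by (auto simp: Y_def)
  have "a_number P = card X"
    unfolding a_number_def X_def using finite_P by (subst card_SigmaI) (auto intro!: sum.cong)
  moreover have "b_number P = card Y"
  proof -
    have inj: "inj_on (\<lambda>((i, j), k). (i, k)) Y"
      using row_unique by (auto simp: inj_on_def Y_def X_def)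
    have "(\<lambda>((i, j), k). (i, k)) ` Y = hook_intersections P"
    proof (intro subset_antisym subsetI)
      fix x assume "x \<in> (\<lambda>((i, j), k). (i, k)) ` Y"
      then obtain i j k where x: "x = (i, k)" and "((i, j), k) \<in> Y" by auto
      then obtain r where *: "(i, j) \<in> P" "j < k" "k < i" "(r, k) \<in> P" "i < r" unfolding memY by blast
      then have "x \<in> hook (i, j) \<inter> hook (r, k)" using hooks_meet_iff[of i j r k x] x by auto
      then show "x \<in> hook_intersections P"
        unfolding hook_intersections_def mem_Collect_eq using *
        by (intro bexI[of _ "(i, j)"] bexI[of _ "(r, k)"] conjI) auto
    next
      fix x assume "x \<in> hook_intersections P"
      then obtain p p' where p: "p \<in> P" "p' \<in> P" "p \<noteq> p'" "x \<in> hook p \<inter> hook p'"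
        unfolding hook_intersections_def mem_Collect_eq by metis
      obtain i j r s where "p = (i, j)" "p' = (r, s)" by (cases p, cases p')
      with p have *: "(i, j) \<in> P" "(r, s) \<in> P" "(i, j) \<noteq> (r, s)" "x \<in> hook (i, j) \<inter> hook (r, s)"
        by simp_all
      from *(4) consider "j < s" "s < i" "i < r" "x = (i, s)" | "s < j" "j < r" "r < i" "x = (r, j)"
        unfolding hooks_meet_iff[OF *(1-3)] by blast
      then show "x \<in> (\<lambda>((i, j), k). (i, k)) ` Y"
      proof cases
        case 1
        then have "((i, j), s) \<in> Y" unfolding memY using * by blast
        then show ?thesis using 1 by (auto simp: image_iff intro!: bexI)
      next
        case 2
        then have "((r, s), j) \<in> Y" unfolding memY using * by blast
        then show ?thesis using 2 by (auto simp: image_iff intro!: bexI)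
      qed
    qed
    then show ?thesis using card_image[OF inj] by (simp add: b_number_def)
  qed
  moreover have "card (Phi n - Rh) = card (X - Y)"
  proof -
    \<comment> \<open>The reflected position \<open>(k, j)\<close> determines the hook, since column
      \<open>j\<close> contains only one main condition.\<close>
    have inj: "inj_on (\<lambda>((i, j), k). (k, j)) (X - Y)"
      using column_unique by (auto simp: inj_on_def Y_def X_def)
    have "(\<lambda>((i, j), k). (k, j)) ` (X - Y) = Phi n - Rh"
    proof (intro subset_antisym subsetI)
      fix x assume "x \<in> (\<lambda>((i, j), k). (k, j)) ` (X - Y)"
      then obtain i j k where x: "x = (k, j)" and "((i, j), k) \<in> X - Y" by auto
      then have *: "(i, j) \<in> P" "j < k" "k < i" "\<not> (\<exists>r. (r, k) \<in> P \<and> i < r)"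
        unfolding Diff_iff memX memY by blast+
      then have "(k, j) \<notin> Rh" unfolding Rh_iff by (meson not_le)
      then show "x \<in> Phi n - Rh" using * memD[OF *(1)] x by (simp add: Phi_def)
    next
      fix x assume "x \<in> Phi n - Rh"
      then obtain k j where x: "x = (k, j)" and *: "j < k" "k < n" "(k, j) \<notin> Rh" by (auto simp: Phi_def)
      then obtain i where "(i, j) \<in> P" "\<not> (i \<le> k \<or> (\<exists>r. (r, k) \<in> P \<and> i < r))" unfolding Rh_iff by blast
      then have "((i, j), k) \<in> X - Y" using * unfolding Diff_iff memX memY by (meson not_le)
      then show "x \<in> (\<lambda>((i, j), k). (k, j)) ` (X - Y)" using x by (force simp: image_iff)
    qed
    then show ?thesis using card_image[OF inj] by simp
  qed
  ultimately show ?thesis using \<open>Y \<subseteq> X\<close> finX by (simp add: card_Diff_subset finite_subset)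
qed

text \<open>Of the ways in which the hook at \<open>(i, j)\<close> can meet those at
  \<open>(s, l)\<close> and \<open>(r, s)\<close>, only one choice for each is compatible with the
  other, and it gives the chain \<open>l < j < s < i < r\<close>.\<close>

lemma connectedE:
  assumes "p \<in> P" "p' \<in> P" "connected_in P p p'"
  obtains i j l r s where "(s, l) \<in> P" "(i, j) \<in> P" "(r, s) \<in> P" "l < j" "j < s" "s < i" "i < r"
proof -
  note result = that
  have *: thesis if "(s, l) \<in> P" "(r, s) \<in> P" "(i, j) \<in> P"
    and c: "card (hook (i, j) \<inter> hook (s, l)) = 1" "card (hook (i, j) \<inter> hook (r, s)) = 1" for s l r i j
  proof -
    have ne: "hook (i, j) \<inter> hook (s, l) \<noteq> {}" "hook (i, j) \<inter> hook (r, s) \<noteq> {}" using c by auto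
    \<comment> \<open>This shows that the connecting hook is a third one, so that
      \<open>hooks_meet_iff\<close> applies to both intersections.\<close>
    have "hook (s, l) \<inter> hook (r, s) = {}"
      using memD[OF that(1)] memD[OF that(2)] by (auto simp: hook_def)
    then have d: "(i, j) \<noteq> (s, l)" "(i, j) \<noteq> (r, s)" using ne by blast+
    have "l < j \<and> j < s \<and> s < i \<or> j < l \<and> l < i \<and> i < s"
      using ne(1) hooks_meet_iff[OF that(3,1) d(1)] by blast
    moreover have "s < j \<and> j < r \<and> r < i \<or> j < s \<and> s < i \<and> i < r"
      using ne(2) hooks_meet_iff[OF that(3,2) d(2)] by blast
    ultimately show thesis using that(1-3) by (intro result[of s l i j r]) auto
  qed
  obtain a b a' b' where pp: "p = (a, b)" "p' = (a', b')" by (cases p, cases p')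
  obtain i j where ij: "(i, j) \<in> P" "card (hook (i, j) \<inter> hook p) = 1" "card (hook (i, j) \<inter> hook p') = 1"
    using assms(3) unfolding connected_in_def by fast
  have "b = a' \<or> b' = a" using assms(3) by (simp add: pp connected_in_def)
  then show thesis
  proof
    assume "b = a'"
    then show thesis using *[of a' b' a i j] assms(1,2) ij by (simp add: pp)
  next
    assume "b' = a"
    then show thesis using *[of a b a' i j] assms(1,2) ij by (simp add: pp)
  qed
qed

end

lemma verge_rook_placement:
  assumes "verge n A"
  shows "rook_placement n (main_conditions n A)"
proof
  show "main_conditions n A \<subseteq> Phi n"
    using assms by (auto simp: verge_def main_conditions_def Phi_def strict_lower_def not_le[symmetric])
qed (use assms in \<open>auto simp: verge_def main_conditions_def\<close>)

subsection \<open>The linear character of a verge\<close>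

locale verge_setup =
  fixes n :: nat and \<theta> :: "'a :: {field, finite} \<Rightarrow> complex" and A :: "'a mat"
  assumes \<theta>: "nontrivial_add_char \<theta>" and verge: "verge n A"
begin

abbreviation P where "P \<equiv> main_conditions n A"

sublocale rook_placement n P
  by (rule verge_rook_placement[OF verge])

text \<open>An explicit formula for the character of the verge, which replaces the description in
  \<open>theta_A\<close>. It is defined on all matrices but multiplicative on the pattern subgroup
  of \<open>R\<close>, where \<open>theta_A_eq\<close> identifies the two.\<close>

definition vchar :: "'a mat \<Rightarrow> complex" where
  "vchar u = \<theta> (\<Sum>p\<in>P. A $$ p * u $$ p)"

lemma \<theta>_add: "\<theta> (x + y) = \<theta> x * \<theta> y" and \<theta>_nonzero: "\<theta> x \<noteq> 0"
  using \<theta> by (auto simp: nontrivial_add_char_def)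

lemma \<theta>_zero: "\<theta> 0 = 1"
  using \<theta>_add[of 0 0] \<theta>_nonzero[of 0] by simp

lemma A_strict_lower: "A \<in> strict_lower n"
  using verge by (simp add: verge_def)

lemma A_nonzero_iff: "a < n \<Longrightarrow> b < n \<Longrightarrow> A $$ (a, b) \<noteq> 0 \<longleftrightarrow> (a, b) \<in> P"
  by (simp add: main_conditions_def)

lemma vchar_cong: "(\<And>i j. (i, j) \<in> P \<Longrightarrow> u $$ (i, j) = u' $$ (i, j)) \<Longrightarrow> vchar u = vchar u'"
  unfolding vchar_def by (intro arg_cong[where f = \<theta>] sum.cong) auto

text \<open>The cross terms of a product live at positions in \<open>Rc\<close>, which contains no
  main condition.\<close>

lemma mult_main_entry:
  assumes u: "u \<in> pattern_subgroup n R" and v: "v \<in> pattern_subgroup n R" and p: "(i, j) \<in> P"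
  shows "(u * v) $$ (i, j) = u $$ (i, j) + v $$ (i, j)"
proof -
  have "(\<Sum>c\<in>{j<..<i}. u $$ (i, c) * v $$ (c, j)) = 0"
    using memD[OF p] p pattern_subgroupD(2)[OF v]
    by (intro product_entries_sum_zero[OF products_R_R u]) (auto simp: R_circ_def)
  then show ?thesis
    using unitri_mult_entry[OF pattern_subgroupD(1)[OF u] pattern_subgroupD(1)[OF v]] memD[OF p] by simp
qed

lemma vchar_mult:
  assumes "u \<in> pattern_subgroup n R" "v \<in> pattern_subgroup n R"
  shows "vchar (u * v) = vchar u * vchar v"
proof -
  have "(\<Sum>p\<in>P. A $$ p * (u * v) $$ p) = (\<Sum>p\<in>P. A $$ p * u $$ p + A $$ p * v $$ p)"
    using mult_main_entry[OF assms] by (intro sum.cong) (auto simp: algebra_simps)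
  then show ?thesis by (simp add: vchar_def sum.distrib \<theta>_add)
qed

lemma vchar_root_elem:
  assumes "j < i" "i < n"
  shows "vchar (root_elem n i j \<alpha>) = (if (i, j) \<in> P then \<theta> (A $$ (i, j) * \<alpha>) else 1)"
proof -
  have "(\<Sum>p\<in>P. A $$ p * root_elem n i j \<alpha> $$ p) = (\<Sum>p\<in>P. if p = (i, j) then A $$ (i, j) * \<alpha> else 0)"
    using memD by (intro sum.cong) (fastforce simp: root_elem_entry)+
  then show ?thesis using finite_P by (simp add: vchar_def \<theta>_zero)
qed

lemma subgroup_R: "subgroup (pattern_subgroup n R) (unitri n :: 'a mat monoid)"
  by (rule subgroup_pattern_subgroup[OF products_R])

lemma subgroup_Rh: "subgroup (pattern_subgroup n Rh) (unitri n :: 'a mat monoid)"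
  by (rule subgroup_pattern_subgroup[OF products_Rh_Rh])

lemma R_mult_closed:
  "u \<in> pattern_subgroup n R \<Longrightarrow> v \<in> pattern_subgroup n R \<Longrightarrow> u * v \<in> (pattern_subgroup n R :: 'a mat set)"
  using subgroup.m_closed[OF subgroup_R] by (simp add: unitri_simps)

lemma linear_character_vchar: "linear_character (unitri n) (pattern_subgroup n R) vchar"
  by (auto simp: linear_character_def unitri_simps vchar_mult) (simp add: vchar_def \<theta>_nonzero)

lemma vchar_trivial: "u \<in> pattern_subgroup n Rc \<Longrightarrow> vchar u = 1"
  unfolding vchar_def using pattern_subgroup_eq_0[of u n Rc] memD
  by (subst sum.neutral) (fastforce simp: R_circ_def \<theta>_zero)+

text \<open>Multiplication by root elements clears the entries of \<open>u\<close> at the main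
  conditions one at a time; what remains lies in the pattern subgroup of \<open>Rc\<close>, where
  both characters are trivial.\<close>

lemma character_eq_vchar:
  assumes \<psi>: "linear_character (unitri n) (pattern_subgroup n R) \<psi>"
    and triv: "\<And>u. u \<in> pattern_subgroup n Rc \<Longrightarrow> \<psi> u = 1"
    and root: "\<And>i j \<alpha>. (i, j) \<in> P \<Longrightarrow> \<psi> (root_elem n i j \<alpha>) = \<theta> (A $$ (i, j) * \<alpha>)"
    and "u \<in> pattern_subgroup n R"
  shows "\<psi> u = vchar u"
  using assms(4)
proof (induction "card {p \<in> P. u $$ p \<noteq> 0}" arbitrary: u rule: less_induct)
  case less
  show ?case
  proof (cases "\<exists>i j. (i, j) \<in> P \<and> u $$ (i, j) \<noteq> 0")
    case False
    then have "u \<in> pattern_subgroup n Rc"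
      using pattern_subgroupD[OF less.prems] by (intro pattern_subgroupI) (auto simp: R_circ_def)
    then show ?thesis using triv vchar_trivial by simp
  next
    case True
    then obtain i j where p: "(i, j) \<in> P" and nz: "u $$ (i, j) \<noteq> 0" by blast
    define x where "x = root_elem n i j (- u $$ (i, j))"
    have x: "x \<in> pattern_subgroup n R"
      unfolding x_def using p P_subset_R memD[OF p] by (intro root_elem_in_pattern_subgroup) auto
    note ux = R_mult_closed[OF less.prems x]
    have entry: "(u * x) $$ (a, b) = (if (a, b) = (i, j) then 0 else u $$ (a, b))" if "(a, b) \<in> P" for a b
      unfolding mult_main_entry[OF less.prems x that] using memD[OF that] by (auto simp: x_def root_elem_entry)
    have "{q \<in> P. (u * x) $$ q \<noteq> 0} \<subset> {q \<in> P. u $$ q \<noteq> 0}"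
    proof (rule psubsetI)
      show "{q \<in> P. (u * x) $$ q \<noteq> 0} \<subseteq> {q \<in> P. u $$ q \<noteq> 0}" using entry by (auto split: if_splits)
      show "{q \<in> P. (u * x) $$ q \<noteq> 0} \<noteq> {q \<in> P. u $$ q \<noteq> 0}" using entry[OF p] p nz by auto
    qed
    then have "\<psi> (u * x) = vchar (u * x)"
      using finite_P by (intro less.hyps psubset_card_mono ux) auto
    moreover have "\<psi> (u * x) = \<psi> u * \<psi> x"
      using \<psi> less.prems x by (simp add: linear_character_def unitri_simps)
    moreover have "\<psi> x = vchar x"
      using root[OF p] memD[OF p] p by (simp add: x_def vchar_root_elem)
    moreover have "\<psi> x \<noteq> 0" using \<psi> x by (simp add: linear_character_def)
    ultimately show ?thesis using vchar_mult[OF less.prems x] by simp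
  qed
qed

lemma theta_A_eq: "theta_A \<theta> n A = restrict vchar (pattern_subgroup n R)"
  unfolding theta_A_def Let_def
proof (rule the_equality, intro conjI ballI)
  show "linear_character (unitri n) (pattern_subgroup n R) (restrict vchar (pattern_subgroup n R))"
    using linear_character_vchar R_mult_closed by (auto simp: linear_character_def unitri_simps)
  show "restrict vchar (pattern_subgroup n R) u = 1" if "u \<in> pattern_subgroup n Rc" for u
    using that pattern_subgroup_mono[OF Rc_subset_R] vchar_trivial[OF that] by auto
  show "case p of (i, j) \<Rightarrow> \<forall>\<alpha>. restrict vchar (pattern_subgroup n R) (root_elem n i j \<alpha>) = \<theta> (A $$ (i, j) * \<alpha>)"
    if "p \<in> P" for p
  proof -
    have "root_elem n i j \<alpha> \<in> pattern_subgroup n R" if "(i, j) \<in> P" for i j and \<alpha> :: 'a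
      using that memD[OF that] P_subset_R by (intro root_elem_in_pattern_subgroup) auto
    then show ?thesis using that memD by (auto simp: vchar_root_elem)
  qed
next
  fix \<psi> assume *: "\<psi> \<in> extensional (pattern_subgroup n R) \<and> linear_character (unitri n) (pattern_subgroup n R) \<psi> \<and>
    (\<forall>u\<in>pattern_subgroup n Rc. \<psi> u = 1) \<and> (\<forall>(i, j)\<in>P. \<forall>\<alpha>. \<psi> (root_elem n i j \<alpha>) = \<theta> (A $$ (i, j) * \<alpha>))"
  have "\<psi> u = vchar u" if "u \<in> pattern_subgroup n R" for u
    by (rule character_eq_vchar[OF _ _ _ that]) (use * in auto)
  then show "\<psi> = restrict vchar (pattern_subgroup n R)"
    using * by (intro extensionalityI[of _ "pattern_subgroup n R"]) auto
qed simp

text \<open>Row \<open>a\<close> of \<open>A\<close> has at most one nonzero entry, say in column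
  \<open>k\<close>. It could spread to column \<open>b\<close> with \<open>k < b < a\<close> only
  through entry \<open>(b, k)\<close> of the inverse, but this position lies above the main
  condition \<open>(a, k)\<close>, hence outside \<open>R\<close>.\<close>

lemma E_dot_A:
  assumes u: "u \<in> pattern_subgroup n R"
  shows "E_dot n A u = A"
proof (rule strict_lower_eqI[OF E_dot_in_strict_lower A_strict_lower])
  let ?v = "inv\<^bsub>unitri n\<^esub> u"
  have v: "?v \<in> pattern_subgroup n R" by (rule pattern_subgroup_inv[OF products_R u])
  note vc = pattern_subgroupD(1)[OF v]
  fix a b assume ab: "b < a" "a < n"
  have "A $$ (a, k) * ?v $$ (b, k) = (if k = b then A $$ (a, b) else 0)" if k: "k < n" for k
  proof (cases "A $$ (a, k) = 0")
    case False
    then have p: "(a, k) \<in> P" using ab k by (simp add: A_nonzero_iff)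
    show ?thesis
    proof (cases k b rule: linorder_cases)
      case less
      then have "(b, k) \<notin> R" using p ab by (auto simp: R_iff)
      then show ?thesis using pattern_subgroup_eq_0[OF v] less ab by simp
    qed (use k ab unitri_carrierD[OF vc] in auto)
  qed auto
  then show "E_dot n A u $$ (a, b) = A $$ (a, b)"
    unfolding E_dot_entry[OF A_strict_lower pattern_subgroupD(1)[OF u] ab] using ab by simp
qed

text \<open>Only main conditions contribute to the sum, and there the entries of \<open>u\<close>
  and its inverse are opposite by \<open>mult_main_entry\<close>.\<close>

lemma chi_A:
  assumes u: "u \<in> pattern_subgroup n R"
  shows "chi \<theta> n A (1\<^sub>m n - inv\<^bsub>unitri n\<^esub> u) = vchar u"
proof -
  let ?v = "inv\<^bsub>unitri n\<^esub> u"
  have v: "?v \<in> pattern_subgroup n R" by (rule pattern_subgroup_inv[OF products_R u])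
  note uc = pattern_subgroupD(1)[OF u] and vc = pattern_subgroupD(1)[OF v]
  have "(\<Sum>i<n. \<Sum>j<n. A $$ (i, j) * (1\<^sub>m n - ?v) $$ (i, j)) = (\<Sum>p\<in>{..<n} \<times> {..<n}. A $$ p * (1\<^sub>m n - ?v) $$ p)"
    by (simp add: sum.cartesian_product case_prod_unfold)
  also have "\<dots> = (\<Sum>p\<in>P. A $$ p * (1\<^sub>m n - ?v) $$ p)"
    by (rule sum.mono_neutral_right) (auto simp: main_conditions_def)
  also have "\<dots> = (\<Sum>p\<in>P. A $$ p * u $$ p)"
  proof (intro sum.cong refl arg_cong2[where f = "(*)"])
    fix p assume "p \<in> P"
    then obtain i j where p: "p = (i, j)" "(i, j) \<in> P" by (cases p) auto
    have "(u * ?v) $$ (i, j) = u $$ (i, j) + ?v $$ (i, j)" by (rule mult_main_entry[OF u v p(2)])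
    then have "u $$ (i, j) = - ?v $$ (i, j)"
      using unitri_inv(3)[OF uc] memD[OF p(2)] by (simp add: eq_neg_iff_add_eq_0)
    then show "(1\<^sub>m n - ?v) $$ p = u $$ p"
      using p memD[OF p(2)] unitri_carrierD(1)[OF vc] by auto
  qed
  finally show ?thesis by (simp add: chi_def vchar_def)
qed

end

subsection \<open>Constituents of minimal dimension\<close>

locale verge_constituent = verge_setup +
  fixes S :: "('a mat \<Rightarrow> complex) set"
  assumes S_subset: "S \<subseteq> orbit_module n A"
    and irreducible: "G_irreducible (unitri n) (E_action \<theta> n) S"
begin

lemma S_supported: "S \<subseteq> supported n"
proof -
  have "E_dot n A ` carrier (unitri n) \<subseteq> strict_lower n" by auto
  then show ?thesis using S_subset orbit_module_subset[of n A] unfolding supported_def by blast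
qed

sublocale right_rep "unitri n :: 'a mat monoid" "E_action \<theta> n" S
proof (intro right_rep.intro unitri_group right_rep_axioms.intro)
  show "G_submodule (unitri n) (E_action \<theta> n) S" using irreducible by (simp add: G_irreducible_def)
qed (use S_supported in \<open>auto simp: finite_unitri linear_E_action E_action_mult \<theta>_add E_action_one \<theta>_zero unitri_simps\<close>)

lemma act_matrix_mult:
  assumes "f \<in> S" "u \<in> carrier (unitri n)" "v \<in> carrier (unitri n)"
  shows "E_action \<theta> n (E_action \<theta> n f u) v = E_action \<theta> n f (u * v)"
  using act_mult[OF assms] by (simp add: unitri_simps)

lemma subspace_weight_space:
  assumes "H \<subseteq> carrier (unitri n)"
  shows "cfun.subspace (weight_space H \<chi>)"
  using subspace assms
  by (auto simp: weight_space_def cfun.subspace_def act_add act_scale act_zero subset_iff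
      cfun.scale_right_distrib mult.commute)

text \<open>
  After translating a vector of \<open>S\<close> so that its coefficient at \<open>A\<close> does not vanish, averaging
  over the stabilizer of \<open>[A]\<close> multiplies this coefficient by the order of the stabilizer.
\<close>

lemma weight_vector_exists: "\<exists>v \<in> weight_space (pattern_subgroup n R) vchar. v \<noteq> 0"
proof -
  let ?U = "pattern_subgroup n R :: 'a mat set"
  interpret H: subgroup ?U "unitri n" by (rule subgroup_R)
  obtain f where f: "f \<in> S" "f \<noteq> 0"
    using irreducible subspace cfun.subspace_0 by (fastforce simp: G_irreducible_def)
  then obtain B where B: "f B \<noteq> 0" by (auto simp: fun_eq_iff)
  then obtain u where u: "u \<in> carrier (unitri n)" "B = E_dot n A u"
    using f(1) S_subset orbit_module_subset[of n A] by blast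
  define u' where "u' = inv\<^bsub>unitri n\<^esub> u"
  define g where "g = E_action \<theta> n f u'"
  have u': "u' \<in> carrier (unitri n)" using unitri_inv[OF u(1)] by (simp add: u'_def)
  have gS: "g \<in> S" using act_closed[OF f(1) u'] by (simp add: g_def)
  have "E_dot n B u' = A" using E_dot_inv_cancel(1)[OF A_strict_lower u(1)] by (simp add: u u'_def)
  then have gA: "g A \<noteq> 0"
    using E_action_E_dot[OF E_dot_in_strict_lower u', of \<theta> f A u] B
    by (simp add: g_def u(2)[symmetric] chi_def \<theta>_nonzero)
  define w where "w = (\<Sum>h\<in>?U. cscale (inverse (vchar h)) (E_action \<theta> n g h))"
  have "E_action \<theta> n w k = cscale (vchar k) w" if "k \<in> ?U" for k
    unfolding w_def by (rule averaged_act(2)[OF subgroup_R linear_character_vchar gS that])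
  moreover have "w \<in> S"
    unfolding w_def using gS act_closed H.mem_carrier
    by (intro cfun.subspace_sum[OF subspace] cfun.subspace_scale[OF subspace]) auto
  moreover have "w A = of_nat (card ?U) * g A"
  proof -
    have "inverse (vchar h) * E_action \<theta> n g h A = g A" if h: "h \<in> ?U" for h
      using E_action_E_dot[OF A_strict_lower H.mem_carrier[OF h], of \<theta> g]
      by (simp add: E_dot_A[OF h] chi_A[OF h]) (simp add: vchar_def \<theta>_nonzero)
    then show ?thesis by (simp add: w_def sum_fun_apply cscale_apply)
  qed
  moreover have "card ?U > 0" using H.finite_imp_card_positive finite_unitri by blast
  ultimately show ?thesis using gA by (intro bexI[of _ w]) (auto simp: weight_space_def)
qed

text \<open>Moving \<open>u\<close> past \<open>x\<close> replaces it by a conjugate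
  \<open>u'\<close> that differs from \<open>u\<close> only at positions of \<open>Rc\<close>, so
  \<open>vchar\<close> does not change.\<close>

lemma weight_space_Rh_invariant:
  assumes w: "w \<in> weight_space (pattern_subgroup n R) vchar" and x: "x \<in> pattern_subgroup n Rh"
  shows "E_action \<theta> n w x \<in> weight_space (pattern_subgroup n R) vchar"
proof -
  note xc = pattern_subgroupD(1)[OF x]
  have wS: "w \<in> S" using w by (simp add: weight_space_def)
  have "E_action \<theta> n (E_action \<theta> n w x) u = cscale (vchar u) (E_action \<theta> n w x)"
    if u: "u \<in> pattern_subgroup n R" for u
  proof -
    obtain u' where u': "u' \<in> pattern_subgroup n R" "x * u = u' * x"
      "\<And>a b. b < a \<Longrightarrow> a < n \<Longrightarrow> (a, b) \<notin> Rc \<Longrightarrow> u' $$ (a, b) = u $$ (a, b)"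
      using pattern_subgroup_conjugate[OF products_Rh_R products_R_Rh Rc_subset_R x u] by blast
    have "vchar u' = vchar u"
      using u'(3) memD by (intro vchar_cong) (auto simp: R_circ_def)
    moreover have "E_action \<theta> n (E_action \<theta> n w x) u = E_action \<theta> n (E_action \<theta> n w u') x"
      using wS xc pattern_subgroupD(1)[OF u] pattern_subgroupD(1)[OF u'(1)]
      by (simp add: act_matrix_mult u'(2))
    ultimately show ?thesis using w u'(1) act_scale[OF xc] by (simp add: weight_space_def)
  qed
  then show ?thesis using act_closed[OF wS xc] by (simp add: weight_space_def)
qed

section \<open>Filtration of the stabilizer by rows\<close>

definition rows_from :: "nat \<Rightarrow> 'a mat set" where
  "rows_from t = pattern_subgroup n {(a, b) \<in> R. t \<le> a}"

lemma rows_from_Suc: "rows_from (Suc t) \<subseteq> rows_from t"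
  unfolding rows_from_def by (rule pattern_subgroup_mono) auto

lemma rows_from_carrier: "rows_from t \<subseteq> carrier (unitri n)"
  by (auto simp: rows_from_def dest: pattern_subgroupD)

text \<open>As \<open>t\<close> runs from 0 to \<open>n\<close>, the groups shrink from the pattern
  subgroup of \<open>R\<close> to the trivial group, and \<open>W t\<close> grows from the weight
  space of the stabilizer to all of \<open>S\<close>.\<close>

abbreviation W where "W t \<equiv> weight_space (rows_from t) vchar"

definition column_elem :: "nat \<Rightarrow> nat set \<Rightarrow> (nat \<Rightarrow> 'a) \<Rightarrow> 'a mat" where
  "column_elem j K c = mat n n (\<lambda>(a, b). if a = b then 1 else if b = j \<and> a \<in> K then c a else 0)"

text \<open>Conjugation by the column element subtracts from column \<open>j\<close> the combination
  of the columns in \<open>K\<close> with coefficients \<open>c\<close>. The only main condition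
  affected is \<open>(t, j)\<close>, so the weight changes by \<open>\<theta>\<close> of a pairing
  between row \<open>t\<close> of \<open>u\<close> and \<open>c\<close>.\<close>

lemma rows_from_conjugate:
  assumes p: "(t, j) \<in> P" and K: "K \<subseteq> {j<..<t}" and u: "u \<in> rows_from t"
  obtains u' where "u' \<in> rows_from t" "column_elem j K c * u = u' * column_elem j K c"
    "vchar u' = vchar u * \<theta> (- (A $$ (t, j) * (\<Sum>k\<in>K. u $$ (t, k) * c k)))"
proof -
  let ?g = "column_elem j K c"
  note jt = memD[OF p]
  have uc: "u \<in> carrier (unitri n)" using u rows_from_carrier by auto
  have u0: "u $$ (a, b) = 0" if "a < t" "b < a" for a b
    using pattern_subgroup_eq_0[OF u[unfolded rows_from_def], of a b] that jt by simp
  have g_entry: "?g $$ (a, b) = (if a = b then 1 else if b = j \<and> a \<in> K then c a else 0)"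
    if "a < n" "b < n" for a b using that by (simp add: column_elem_def)
  have gc: "?g \<in> carrier (unitri n)"
    using K by (auto simp: unitri_def g_entry) (auto simp: column_elem_def)
  obtain u' where u': "u' \<in> carrier (unitri n)" "?g * u = u' * ?g"
    "\<And>a b. b < a \<Longrightarrow> a < n \<Longrightarrow> u' $$ (a, b) = u $$ (a, b)
      + (\<Sum>k\<in>{b<..<a}. ?g $$ (a, k) * u $$ (k, b)) - (\<Sum>k\<in>{b<..<a}. u' $$ (a, k) * ?g $$ (k, b))"
    using conjugate_exists[OF gc uc] by blast
  \<comment> \<open>Left multiplication by the column element adds multiples of row \<open>j\<close>
    of \<open>u\<close>, which is trivial below the diagonal because \<open>j < t\<close>.\<close>
  have first_zero: "(\<Sum>k\<in>{b<..<a}. ?g $$ (a, k) * u $$ (k, b)) = 0" if "a < n" for a b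
    using that u0 jt by (intro sum.neutral) (auto simp: g_entry)
  have other: "u' $$ (a, b) = u $$ (a, b)" if "b < a" "a < n" "b \<noteq> j" for a b
  proof -
    have "(\<Sum>k\<in>{b<..<a}. u' $$ (a, k) * ?g $$ (k, b)) = 0"
      using that by (intro sum.neutral) (auto simp: g_entry)
    then show ?thesis using u'(3)[OF that(1,2)] first_zero[OF that(2)] by simp
  qed
  have column: "u' $$ (a, j) = u $$ (a, j) - (\<Sum>k\<in>{j<..<a}. u $$ (a, k) * (if k \<in> K then c k else 0))"
    if "j < a" "a < n" for a
  proof -
    have "(\<Sum>k\<in>{j<..<a}. u' $$ (a, k) * ?g $$ (k, j)) = (\<Sum>k\<in>{j<..<a}. u $$ (a, k) * (if k \<in> K then c k else 0))"
      using that by (intro sum.cong) (auto simp: g_entry other)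
    then show ?thesis using u'(3)[OF that] first_zero[OF that(2)] by simp
  qed
  have "u' \<in> rows_from t"
    unfolding rows_from_def
  proof (rule pattern_subgroupI[OF u'(1)])
    fix a b assume ab: "b < a" "a < n" "u' $$ (a, b) \<noteq> 0"
    show "(a, b) \<in> {(a, b) \<in> R. t \<le> a}"
    proof (cases "b = j")
      case False
      then have "u $$ (a, b) \<noteq> 0" using ab other[OF ab(1,2)] by simp
      then show ?thesis by (rule pattern_subgroupD(2)[OF u[unfolded rows_from_def] ab(1,2)])
    next
      case True
      \<comment> \<open>The changed column stays inside \<open>R\<close>: from its main condition
        \<open>(t, j)\<close> downwards the whole column belongs to \<open>R\<close>.\<close>
      have "t \<le> a"
      proof (rule ccontr)
        assume "\<not> t \<le> a"
        then have "u' $$ (a, j) = 0" using column[of a] ab True u0 by simp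
        then show False using ab True by simp
      qed
      moreover have "i \<le> a" if "(i, j) \<in> P" for i
        using column_unique[OF that p] \<open>t \<le> a\<close> by simp
      ultimately show ?thesis using ab True by (simp add: R_iff)
    qed
  qed
  moreover have "vchar u' = vchar u * \<theta> (- (A $$ (t, j) * (\<Sum>k\<in>K. u $$ (t, k) * c k)))"
  proof -
    have "(\<Sum>k\<in>{j<..<t}. u $$ (t, k) * (if k \<in> K then c k else 0)) = (\<Sum>k\<in>{j<..<t}. if k \<in> K then u $$ (t, k) * c k else 0)"
      by (intro sum.cong) auto
    also have "\<dots> = (\<Sum>k\<in>K. u $$ (t, k) * c k)"
      using K by (simp add: sum.inter_restrict[symmetric] Int_absorb1)
    finally have tj: "u' $$ (t, j) = u $$ (t, j) - (\<Sum>k\<in>K. u $$ (t, k) * c k)"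
      using column[of t] jt by simp
    have entry: "u' $$ (a, b) = u $$ (a, b)" if "(a, b) \<in> P" "(a, b) \<noteq> (t, j)" for a b
      using other[of b a] memD[OF that(1)] column_unique[OF that(1), of t] that p by (cases "b = j") auto
    have "(\<Sum>q\<in>P. A $$ q * u' $$ q) = (\<Sum>q\<in>P. A $$ q * u $$ q +
        (if q = (t, j) then - (A $$ (t, j) * (\<Sum>k\<in>K. u $$ (t, k) * c k)) else 0))"
      using entry by (intro sum.cong) (auto simp: tj right_diff_distrib)
    also have "\<dots> = (\<Sum>q\<in>P. A $$ q * u $$ q) - A $$ (t, j) * (\<Sum>k\<in>K. u $$ (t, k) * c k)"
      using finite_P p by (simp add: sum.distrib)
    finally show ?thesis by (simp add: vchar_def \<theta>_add[symmetric])
  qed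
  ultimately show thesis using that u'(2) by blast
qed

definition free_column :: "nat \<Rightarrow> nat set" where
  "free_column j = {k. (k, j) \<in> Phi n - Rh}"

lemma free_column_iff:
  assumes p: "(t, j) \<in> P"
  shows "k \<in> free_column j \<longleftrightarrow> j < k \<and> k < t \<and> (\<forall>r. (r, k) \<in> P \<longrightarrow> r \<le> t)"
proof -
  have "(\<forall>i. (i, j) \<in> P \<longrightarrow> Q i) \<longleftrightarrow> Q t" for Q
    using p column_unique[OF p] by blast
  then have "(k, j) \<in> Rh \<longleftrightarrow> j < k \<and> k < n \<and> (t \<le> k \<or> (\<exists>r. (r, k) \<in> P \<and> t < r))"
    unfolding Rh_iff by simp
  then show ?thesis
    using memD[OF p] unfolding free_column_def Phi_def by (auto simp: not_le not_less)
qed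

lemma free_column_subset: "(t, j) \<in> P \<Longrightarrow> free_column j \<subseteq> {j<..<t}"
  by (auto simp: free_column_iff)

text \<open>For free \<open>k\<close>, column \<open>k\<close> has no main condition below row
  \<open>t\<close>, so \<open>(t, k)\<close> lies in \<open>R\<close>. The root elements there are
  the test elements that read off the coefficient \<open>c k\<close> from a translated
  weight.\<close>

lemma free_column_root_elem:
  assumes p: "(t, j) \<in> P" and k: "k \<in> free_column j"
  shows "root_elem n t k \<alpha> \<in> rows_from t" "vchar (root_elem n t k \<alpha>) = 1"
proof -
  have jk: "j < k" "k < t" and "\<forall>r. (r, k) \<in> P \<longrightarrow> r \<le> t"
    using k unfolding free_column_iff[OF p] by blast+
  then have "(t, k) \<in> R" using memD[OF p] unfolding R_iff by simp
  then show "root_elem n t k \<alpha> \<in> rows_from t"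
    unfolding rows_from_def using jk by (intro root_elem_in_pattern_subgroup) auto
  have "(t, k) \<notin> P" using row_unique[OF p] jk by auto
  then show "vchar (root_elem n t k \<alpha>) = 1" using jk memD[OF p] by (simp add: vchar_root_elem)
qed

text \<open>
  A vector of weight \<open>vchar\<close> for the rows from \<open>t\<close> is translated by the elements
  \<^term>\<open>column_elem j K c\<close>; row \<open>t\<close> separates the resulting weights, which agree below row \<open>t\<close>.
\<close>

lemma independent_in_W_Suc:
  assumes p: "(t, j) \<in> P" and B: "B \<subseteq> W t" "finite B" "cfun.independent B"
  obtains B' where "B' \<subseteq> W (Suc t)" "finite B'" "cfun.independent B'"
    "card B' = card (UNIV :: 'a set) ^ card (free_column j) * card B"
proof -
  let ?K = "free_column j"
  have finK: "finite ?K" by (rule finite_subset[OF free_column_subset[OF p]]) simp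
  define C where "C = ?K \<rightarrow>\<^sub>E (UNIV :: 'a set)"
  define \<chi> where "\<chi> c u = vchar u * \<theta> (- (A $$ (t, j) * (\<Sum>k\<in>?K. u $$ (t, k) * c k)))" for c u
  define g where "g c = column_elem j ?K c" for c
  have gc: "g c \<in> carrier (unitri n)" for c
    using free_column_subset[OF p] by (auto simp: g_def column_elem_def unitri_def)
  have weight: "E_action \<theta> n b (g c) \<in> weight_space (rows_from t) (\<chi> c)" if b: "b \<in> W t" for b c
  proof -
    have bS: "b \<in> S" using b by (simp add: weight_space_def)
    have "E_action \<theta> n (E_action \<theta> n b (g c)) u = cscale (\<chi> c u) (E_action \<theta> n b (g c))" if u: "u \<in> rows_from t" for u
    proof -
      obtain u' where u': "u' \<in> rows_from t" "g c * u = u' * g c" "vchar u' = \<chi> c u"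
        unfolding g_def \<chi>_def using rows_from_conjugate[OF p free_column_subset[OF p] u] by blast
      then have "E_action \<theta> n (E_action \<theta> n b (g c)) u = E_action \<theta> n (E_action \<theta> n b u') (g c)"
        using bS gc u rows_from_carrier by (simp add: act_matrix_mult subset_iff)
      then show ?thesis using b u'(1,3) act_scale[OF gc] by (simp add: weight_space_def)
    qed
    then show ?thesis using act_closed[OF bS gc] by (simp add: weight_space_def)
  qed
  have distinct: "\<exists>u\<in>rows_from t. \<chi> c u \<noteq> \<chi> d u" if cd: "c \<in> C" "d \<in> C" "c \<noteq> d" for c d
  proof -
    obtain k where k: "k \<in> ?K" "c k \<noteq> d k"
      using cd unfolding C_def by (meson PiE_ext)
    obtain x where x: "\<theta> x \<noteq> 1" using \<theta> by (auto simp: nontrivial_add_char_def)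
    have Atj: "A $$ (t, j) \<noteq> 0" using p by (simp add: main_conditions_def)
    \<comment> \<open>Chosen so that the weights for \<open>c\<close> and \<open>d\<close> at the
      root element differ by the factor \<open>\<theta> x \<noteq> 1\<close>.\<close>
    define \<alpha> where "\<alpha> = x / (A $$ (t, j) * (d k - c k))"
    have \<chi>_root: "\<chi> e (root_elem n t k \<alpha>) = \<theta> (- (A $$ (t, j) * (\<alpha> * e k)))" for e
    proof -
      have "(\<Sum>l\<in>?K. root_elem n t k \<alpha> $$ (t, l) * e l) = (\<Sum>l\<in>?K. if l = k then \<alpha> * e k else 0)"
        using free_column_subset[OF p] memD[OF p] by (intro sum.cong) (auto simp: root_elem_entry)
      then show ?thesis using finK k(1) by (simp add: \<chi>_def free_column_root_elem[OF p k(1)])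
    qed
    have "x = A $$ (t, j) * (d k - c k) * \<alpha>" using k(2) Atj by (simp add: \<alpha>_def)
    then have "- (A $$ (t, j) * (\<alpha> * c k)) = - (A $$ (t, j) * (\<alpha> * d k)) + x"
      by (simp add: algebra_simps)
    then have "\<chi> c (root_elem n t k \<alpha>) = \<chi> d (root_elem n t k \<alpha>) * \<theta> x"
      by (simp only: \<chi>_root \<theta>_add)
    moreover have "\<chi> d (root_elem n t k \<alpha>) \<noteq> 0"
      unfolding \<chi>_root by (rule \<theta>_nonzero)
    ultimately have "\<chi> c (root_elem n t k \<alpha>) \<noteq> \<chi> d (root_elem n t k \<alpha>)"
      using x by simp
    then show ?thesis using free_column_root_elem(1)[OF p k(1)] by blast
  qed
  define B' where "B' = (\<lambda>(c, b). E_action \<theta> n b (g c)) ` (C \<times> B)"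
  have finC: "finite C" unfolding C_def using finK by (intro finite_PiE) auto
  have sub: "cfun.subspace (W t)" by (rule subspace_weight_space[OF rows_from_carrier])
  have WS: "W t \<subseteq> S" by (auto simp: weight_space_def)
  note B' = translated_weight_vectors[where C = C and t = g and \<chi> = \<chi>, OF rows_from_carrier finC gc weight distinct WS sub B, folded B'_def]
  have "E_action \<theta> n b (g c) \<in> W (Suc t)" if b: "b \<in> W t" for b c
  proof -
    have "\<chi> c u = vchar u" if u: "u \<in> rows_from (Suc t)" for u
    proof -
      have "u $$ (t, k) = 0" if "k \<in> ?K" for k
        using pattern_subgroup_eq_0[OF u[unfolded rows_from_def], of t k] that free_column_subset[OF p] memD[OF p]
        by auto
      then show ?thesis by (simp add: \<chi>_def \<theta>_zero)
    qed
    then show ?thesis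
      using weight[OF b, of c] rows_from_Suc[of t] by (auto simp: weight_space_def)
  qed
  then have "B' \<subseteq> W (Suc t)" using B(1) by (auto simp: B'_def)
  moreover have "finite B'" using finC B(2) by (simp add: B'_def)
  moreover have "card C = card (UNIV :: 'a set) ^ card ?K" by (simp add: C_def card_PiE finK)
  ultimately show thesis using that B' by simp
qed

text \<open>The number of these positions is the exponent still to be gained from row
  \<open>t\<close> on. For \<open>t = 0\<close> they are all of \<open>Phi n - Rh\<close>, since a
  position outside \<open>Rh\<close> lies in a column with a main condition.\<close>

definition free_positions :: "nat \<Rightarrow> (nat \<times> nat) set" where
  "free_positions t = {(k, j) \<in> Phi n - Rh. \<exists>i\<ge>t. (i, j) \<in> P}"

lemma finite_Phi: "finite (Phi n)"
  by (rule finite_subset[of _ "{..<n} \<times> {..<n}"]) (auto simp: Phi_def)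

lemma card_free_positions_Suc:
  assumes p: "(t, j) \<in> P"
  shows "card (free_positions t) = card (free_column j) + card (free_positions (Suc t))"
proof -
  have "free_positions t = (\<lambda>k. (k, j)) ` free_column j \<union> free_positions (Suc t)"
  proof (intro subset_antisym subsetI)
    fix x assume "x \<in> free_positions t"
    then obtain k l i where x: "x = (k, l)" "(k, l) \<in> Phi n - Rh" "t \<le> i" "(i, l) \<in> P"
      by (auto simp: free_positions_def)
    show "x \<in> (\<lambda>k. (k, j)) ` free_column j \<union> free_positions (Suc t)"
    proof (cases "i = t")
      case True
      then have "l = j" using row_unique[OF p] x(4) by auto
      then show ?thesis using x by (auto simp: free_column_def)
    next
      case False
      then have "Suc t \<le> i" using x(3) by simp
      then show ?thesis using x unfolding free_positions_def by blast
    qed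
  next
    fix x assume "x \<in> (\<lambda>k. (k, j)) ` free_column j \<union> free_positions (Suc t)"
    then show "x \<in> free_positions t"
      using p unfolding free_positions_def free_column_def by (auto intro: Suc_leD)
  qed
  moreover have "(\<lambda>k. (k, j)) ` free_column j \<inter> free_positions (Suc t) = {}"
    using column_unique[OF p] by (fastforce simp: free_positions_def)
  moreover have "finite (free_column j)"
    by (rule finite_subset[OF free_column_subset[OF p]]) simp
  moreover have "finite (free_positions (Suc t))"
    using finite_Phi by (rule finite_subset[rotated]) (auto simp: free_positions_def)
  ultimately show ?thesis
    by (simp add: card_Un_disjoint card_image inj_on_def)
qed

text \<open>Each row with a main condition contributes the factor of
  \<open>independent_in_W_Suc\<close> in passing from \<open>W t\<close> to
  \<open>W (Suc t)\<close>; in the other rows \<open>B\<close> itself is carried over. At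
  \<open>t = n\<close> the vectors are just elements of \<open>S\<close>.\<close>

lemma independent_in_S:
  assumes "t \<le> n" "B \<subseteq> W t" "finite B" "cfun.independent B"
  shows "\<exists>B'\<subseteq>S. cfun.independent B' \<and> finite B' \<and>
    card B' = card (UNIV :: 'a set) ^ card (free_positions t) * card B"
  using assms
proof (induction t arbitrary: B rule: inc_induct)
  case base
  have "free_positions n = {}" using memD by (fastforce simp: free_positions_def)
  moreover have "B \<subseteq> S" using base by (auto simp: weight_space_def)
  ultimately show ?case using base by (intro exI[of _ B]) auto
next
  case (step t)
  show ?case
  proof (cases "\<exists>j. (t, j) \<in> P")
    case True
    then obtain j where p: "(t, j) \<in> P" by blast
    obtain B1 where B1: "B1 \<subseteq> W (Suc t)" "finite B1" "cfun.independent B1"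
      "card B1 = card (UNIV :: 'a set) ^ card (free_column j) * card B"
      by (rule independent_in_W_Suc[OF p step.prems])
    then show ?thesis
      using step.IH[OF B1(1-3)] by (simp add: card_free_positions_Suc[OF p] power_add mult_ac)
  next
    case False
    have "W t \<subseteq> W (Suc t)" using rows_from_Suc[of t] by (auto simp: weight_space_def)
    moreover have "free_positions t = free_positions (Suc t)"
      using False le_less_Suc_eq unfolding free_positions_def by (metis (no_types, opaque_lifting) Suc_le_eq le_less)
    ultimately show ?thesis using step.IH[of B] step.prems by auto
  qed
qed

text \<open>For \<open>t = 0\<close> the construction yields \<open>cfun.dim S * card B\<close>
  independent vectors in \<open>S\<close>. Hence the weight space of the stabilizer contains no two
  independent vectors.\<close>

lemma card_independent_weight_vectors:
  assumes B: "B \<subseteq> weight_space (pattern_subgroup n R) vchar" "finite B" "cfun.independent B"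
    and dim: "cfun.dim S = card (UNIV :: 'a set) ^ card (Phi n - Rh)"
  shows "card B \<le> 1"
proof -
  have "rows_from 0 = pattern_subgroup n R" by (simp add: rows_from_def)
  moreover have "free_positions 0 = Phi n - Rh"
  proof -
    have "\<exists>i. (i, j) \<in> P" if "(k, j) \<in> Phi n - Rh" for k j
      using that unfolding Phi_def Diff_iff Rh_iff by blast
    then show ?thesis unfolding free_positions_def by auto
  qed
  ultimately obtain B' where B': "B' \<subseteq> S" "cfun.independent B'"
    "card B' = card (UNIV :: 'a set) ^ card (Phi n - Rh) * card B"
    using independent_in_S[of 0 B] B by auto
  obtain D where D: "D \<subseteq> S" "S \<subseteq> cfun.span D" "card D = cfun.dim S"
    using cfun.basis_exists by metis
  have pos: "cfun.dim S > 0" using dim by (simp add: finite_UNIV_card_ge_0)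
  then have "finite D" using D(3) card_ge_0_finite by metis
  then have "card B' \<le> cfun.dim S"
    using cfun.independent_span_bound[of D B'] B' D by auto
  then have "cfun.dim S * card B \<le> cfun.dim S * 1" using B'(3) dim by simp
  then show ?thesis using pos by (simp only: mult_le_cancel1)
qed

section \<open>Extension of the character and the monomial source\<close>

lemma extension_exists:
  assumes dim: "cfun.dim S = card (UNIV :: 'a set) ^ card (Phi n - Rh)"
  obtains \<psi> v where "linear_character (unitri n) (pattern_subgroup n Rh) \<psi>"
    "\<And>u. u \<in> pattern_subgroup n R \<Longrightarrow> \<psi> u = vchar u"
    "v \<in> weight_space (pattern_subgroup n Rh) \<psi>" "v \<noteq> 0"
proof -
  let ?W = "weight_space (pattern_subgroup n R) vchar"
  obtain v where v: "v \<in> ?W" "v \<noteq> 0" using weight_vector_exists by blast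
  have vS: "v \<in> S" using v by (simp add: weight_space_def)
  have multiple: "\<exists>c. w = cscale c v" if w: "w \<in> ?W" for w
  proof (rule ccontr)
    assume no: "\<nexists>c. w = cscale c v"
    have "w \<noteq> v" using no by (metis cfun.scale_one)
    have "w \<notin> cfun.span {v}" using no by (auto simp: cfun.span_singleton)
    moreover have "cfun.independent {v}" using v(2) by (metis cfun.dependent_single)
    ultimately have "cfun.independent {w, v}" by (rule cfun.independent_insertI)
    then have "card {w, v} \<le> 1" using w v(1) by (intro card_independent_weight_vectors dim) auto
    then show False using \<open>w \<noteq> v\<close> by simp
  qed
  \<comment> \<open>The weight space is a line stable under the pattern subgroup of
    \<open>Rh\<close>, so every element acts on \<open>v\<close> by a scalar; these scalars are the
    required extension.\<close>
  have "\<forall>x\<in>pattern_subgroup n Rh. \<exists>c. E_action \<theta> n v x = cscale c v"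
    using weight_space_Rh_invariant[OF v(1)] multiple by blast
  then obtain \<psi> where \<psi>: "\<And>x. x \<in> pattern_subgroup n Rh \<Longrightarrow> E_action \<theta> n v x = cscale (\<psi> x) v"
    by metis
  interpret H: subgroup "pattern_subgroup n Rh :: 'a mat set" "unitri n" by (rule subgroup_Rh)
  have "\<psi> x \<noteq> 0" if x: "x \<in> pattern_subgroup n Rh" for x
    using \<psi>[OF x] act_eq_0_iff[OF vS H.mem_carrier[OF x]] v(2) by (metis cfun.scale_zero_left)
  moreover have "\<psi> (x \<otimes>\<^bsub>unitri n\<^esub> y) = \<psi> x * \<psi> y" if x: "x \<in> pattern_subgroup n Rh" and y: "y \<in> pattern_subgroup n Rh" for x y
  proof -
    have "cscale (\<psi> (x \<otimes>\<^bsub>unitri n\<^esub> y)) v = E_action \<theta> n (E_action \<theta> n v x) y"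
      using \<psi>[OF H.m_closed[OF x y]] act_mult[OF vS H.mem_carrier[OF x] H.mem_carrier[OF y]] by simp
    also have "\<dots> = cscale (\<psi> x * \<psi> y) v"
      by (simp add: \<psi>[OF x] \<psi>[OF y] act_scale[OF H.mem_carrier[OF y]])
    finally show ?thesis by (rule cfun_cong_coeff) (rule v(2))
  qed
  ultimately have "linear_character (unitri n) (pattern_subgroup n Rh) \<psi>"
    by (simp add: linear_character_def)
  moreover have "\<psi> u = vchar u" if u: "u \<in> pattern_subgroup n R" for u
  proof (rule cfun_cong_coeff[OF _ v(2)])
    have uh: "u \<in> pattern_subgroup n Rh" using u pattern_subgroup_mono[OF R_subset_Rh] by blast
    have "E_action \<theta> n v u = cscale (vchar u) v" using v(1) u by (simp add: weight_space_def)
    with \<psi>[OF uh, symmetric] show "cscale (\<psi> u) v = cscale (vchar u) v" by (rule trans)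
  qed
  moreover have "v \<in> weight_space (pattern_subgroup n Rh) \<psi>" using vS \<psi> by (simp add: weight_space_def)
  ultimately show thesis using that v(2) by blast
qed

text \<open>The dimension of \<open>S\<close> times the order of the pattern subgroup of
  \<open>Rh\<close> is the order of the whole group, as the exponents add up to
  \<open>card (Phi n)\<close>.\<close>

lemma isomorphic_induced:
  assumes dim: "cfun.dim S = card (UNIV :: 'a set) ^ card (Phi n - Rh)"
    and "linear_character (unitri n) (pattern_subgroup n Rh) \<psi>"
    and "v \<in> weight_space (pattern_subgroup n Rh) \<psi>" "v \<noteq> 0"
  shows "G_isomorphic (unitri n) (E_action \<theta> n) S
    (induced_action (unitri n)) (induced_module (unitri n) (pattern_subgroup n Rh) \<psi>)"
proof (rule isomorphic_induced_module[OF irreducible subgroup_Rh assms(2-4)])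
  have "card (Phi n - Rh) + card Rh = card (Phi n)"
    using Rh_subset_Phi finite_Phi by (metis add.commute card_Diff_subset card_mono finite_subset le_add_diff_inverse)
  then show "cfun.dim S * card (pattern_subgroup n Rh :: 'a mat set) = Coset.order (unitri n :: 'a mat monoid)"
    using card_pattern_subgroup[OF Rh_subset_Phi, where ?'a = 'a] card_pattern_subgroup[of "Phi n" n, where ?'a = 'a]
    by (simp add: dim Coset.order_def pattern_subgroup_Phi power_add[symmetric])
qed

end

text \<open>
  If the main conditions \<open>(s, l)\<close> and \<open>(r, s)\<close> are connected through \<open>(i, j)\<close>, then the root
  subgroup at \<open>(s, l)\<close> consists of commutators in the pattern subgroup of \<^term>\<open>R_hat\<close>.
\<close>

lemma (in verge_setup) hook_disconnected_if_extends:
  assumes \<psi>: "linear_character (unitri n) (pattern_subgroup n Rh) \<psi>"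
    and ext: "\<And>u. u \<in> pattern_subgroup n R \<Longrightarrow> \<psi> u = vchar u"
  shows "hook_disconnected P"
  unfolding hook_disconnected_def
proof
  assume "\<exists>p\<in>P. \<exists>p'\<in>P. connected_in P p p'"
  then obtain i j l r s where sl: "(s, l) \<in> P" and ij: "(i, j) \<in> P" and rs: "(r, s) \<in> P"
    and less: "l < j" "j < s" "s < i" "i < r"
    by (metis connectedE)
  have sn: "s < n" using memD[OF sl] by simp
  \<comment> \<open>Both positions are of the kind added in \<open>R_hat\<close>:
    \<open>(s, j)\<close> comes from the pair \<open>(i, j)\<close>, \<open>(r, s)\<close>, and
    \<open>(j, l)\<close> from the pair \<open>(s, l)\<close>, \<open>(i, j)\<close>.\<close>
  have sj: "(s, j) \<in> Rh" "(j, l) \<in> Rh"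
  proof -
    have "i' = i" if "(i', j) \<in> P" for i' by (rule column_unique[OF that ij])
    then show "(s, j) \<in> Rh" unfolding Rh_iff using less sn rs by blast
    have "\<exists>i. (i, j) \<in> P \<and> s' < i" if "(s', l) \<in> P" for s'
      using column_unique[OF that sl] ij less by blast
    then show "(j, l) \<in> Rh" unfolding Rh_iff using less sn by simp
  qed
  have "\<theta> x = 1" for x
  proof -
    \<comment> \<open>Normalized so that the commutator \<open>z\<close> of \<open>a\<close> and
      \<open>b\<close> has \<open>vchar z = \<theta> x\<close>.\<close>
    define \<beta> where "\<beta> = x / A $$ (s, l)"
    define a b z where "a = (root_elem n s j 1 :: 'a mat)" and "b = root_elem n j l \<beta>" and "z = root_elem n s l \<beta>"
    have a: "a \<in> pattern_subgroup n Rh" and b: "b \<in> pattern_subgroup n Rh" and z: "z \<in> pattern_subgroup n R"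
      unfolding a_def b_def z_def using sj less sl P_subset_R by (auto intro!: root_elem_in_pattern_subgroup)
    have zh: "z \<in> pattern_subgroup n Rh" using z pattern_subgroup_mono[OF R_subset_Rh] by blast
    note ac = pattern_subgroupD(1)[OF a] and bc = pattern_subgroupD(1)[OF b] and zc = pattern_subgroupD(1)[OF z]
    note entries = root_elem_entry
    have ab: "(a * b) $$ (c, d) = a $$ (c, d) + b $$ (c, d) + (if c = s \<and> d = l then \<beta> else 0)"
      if cd: "d < c" "c < n" for c d
    proof -
      have "(\<Sum>k\<in>{d<..<c}. a $$ (c, k) * b $$ (k, d)) = (\<Sum>k\<in>{d<..<c}. if k = j then (if c = s \<and> d = l then \<beta> else 0) else 0)"
        using cd sn less by (intro sum.cong) (auto simp: a_def b_def entries)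
      then show ?thesis using unitri_mult_entry[OF ac bc cd] less by auto
    qed
    have ba: "(b * a) $$ (c, d) = b $$ (c, d) + a $$ (c, d)" if cd: "d < c" "c < n" for c d
    proof -
      have "(\<Sum>k\<in>{d<..<c}. b $$ (c, k) * a $$ (k, d)) = 0"
        using cd sn less by (intro sum.neutral) (auto simp: a_def b_def entries)
      then show ?thesis using unitri_mult_entry[OF bc ac cd] by simp
    qed
    note bac = unitri_mult_carrier[OF bc ac]
    have zba: "(z * (b * a)) $$ (c, d) = z $$ (c, d) + (b * a) $$ (c, d)" if cd: "d < c" "c < n" for c d
    proof -
      have "(b * a) $$ (l, d) = 0" if "d < l"
        using ba[OF that] that sn less by (simp add: a_def b_def entries)
      then have "(\<Sum>k\<in>{d<..<c}. z $$ (c, k) * (b * a) $$ (k, d)) = 0"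
        using cd sn less by (intro sum.neutral) (auto simp: z_def entries)
      then show ?thesis using unitri_mult_entry[OF zc bac cd] by simp
    qed
    have "a * b = z * (b * a)"
    proof (rule unitri_eqI[OF unitri_mult_carrier[OF ac bc] unitri_mult_carrier[OF zc bac]])
      fix c d assume cd: "d < c" "c < n"
      show "(a * b) $$ (c, d) = (z * (b * a)) $$ (c, d)"
        unfolding ab[OF cd] zba[OF cd] ba[OF cd] using cd by (auto simp: z_def entries)
    qed
    moreover have mult: "\<psi> (x * y) = \<psi> x * \<psi> y" if "x \<in> pattern_subgroup n Rh" "y \<in> pattern_subgroup n Rh" for x y
      using \<psi> that by (simp add: linear_character_def unitri_simps)
    moreover have "b * a \<in> pattern_subgroup n Rh"
      using subgroup.m_closed[OF subgroup_Rh b a] by (simp add: unitri_simps)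
    ultimately have "\<psi> a * \<psi> b = \<psi> z * (\<psi> b * \<psi> a)" using a b zh by metis
    moreover have "\<psi> a \<noteq> 0" "\<psi> b \<noteq> 0" using \<psi> a b by (auto simp: linear_character_def)
    ultimately have "\<psi> z = 1" by simp
    moreover have "\<psi> z = \<theta> x"
      using ext[OF z] sl less sn by (simp add: z_def vchar_root_elem \<beta>_def main_conditions_def)
    ultimately show "\<theta> x = 1" by simp
  qed
  then show False using \<theta> by (simp add: nontrivial_add_char_def)
qed

theorem corollary6p12:
  fixes n :: nat
    and \<theta> :: "'a :: {field, finite} \<Rightarrow> complex"
    and A :: "'a mat"
    and S :: "('a mat \<Rightarrow> complex) set"
  assumes "nontrivial_add_char \<theta>"
    and "verge n A"
    and "S \<subseteq> orbit_module n A"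
    and "G_irreducible (unitri n) (E_action \<theta> n) S"
    and "minimal_dimension n A S"
  shows "hook_disconnected (main_conditions n A) \<and>
    (\<exists>\<psi> :: 'a mat \<Rightarrow> complex.
       linear_character (unitri n) (pattern_subgroup n (R_hat n (main_conditions n A))) \<psi> \<and>
       (\<forall>u \<in> pattern_subgroup n (R_circ n (main_conditions n A)). \<psi> u = 1) \<and>
       restrict \<psi> (pattern_subgroup n (R_set n (main_conditions n A))) = theta_A \<theta> n A \<and>
       monomial_source \<theta> n (pattern_subgroup n (R_hat n (main_conditions n A))) \<psi> S)"
proof -
  interpret verge_constituent n \<theta> A S
    by unfold_locales (fact assms)+
  \<comment> \<open>The exponent of the minimal dimension counts the positions outside
    \<open>Rh\<close>, which is the form that the weight argument and the index computation
    use.\<close>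
  have dim: "cfun.dim S = card (UNIV :: 'a set) ^ card (Phi n - Rh)"
    using assms(5) by (simp add: minimal_dimension_def card_Phi_minus_Rh)
  obtain \<psi> v where \<psi>: "linear_character (unitri n) (pattern_subgroup n Rh) \<psi>"
    and ext: "\<And>u. u \<in> pattern_subgroup n R \<Longrightarrow> \<psi> u = vchar u"
    and v: "v \<in> weight_space (pattern_subgroup n Rh) \<psi>" "v \<noteq> 0"
    using extension_exists[OF dim] by blast
  have "\<psi> u = 1" if "u \<in> pattern_subgroup n Rc" for u
  proof -
    have "u \<in> pattern_subgroup n R" using that pattern_subgroup_mono[OF Rc_subset_R] by blast
    then show ?thesis using ext vchar_trivial[OF that] by simp
  qed
  moreover have "restrict \<psi> (pattern_subgroup n R) = theta_A \<theta> n A"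
    unfolding theta_A_eq using ext by (rule restrict_ext)
  moreover have "monomial_source \<theta> n (pattern_subgroup n Rh) \<psi> S"
    unfolding monomial_source_def by (rule isomorphic_induced[OF dim \<psi> v])
  ultimately show ?thesis
    using hook_disconnected_if_extends[OF \<psi> ext] \<psi> by blast
qed

end
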